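(* Let $n\ge 2$ and consider a KdV-like evolution equation $$\frac{\partial u}{\partial t}=u_n+f(u,u_1,\dots,u_{n-1}),\qquad \frac{\partial f}{\partial u_{n-1}}=\mathrm{const},$$ which is non-linearizable, i.e. it cannot be linearized by means of contact transformations. Let $S$ be the set of all its symmetries and, for $k=0,1,2,\dots$, let $S^{(k)}=\{G\in S:\ {\rm ord}\,G\le k\}$. Then $\dim S^{(k)}<\infty$ for every $k=0,1,2,\dots$, and any symmetry $Q$ of order $k$ is a linear combination of symmetries of the form $$H=\exp(\lambda t)\sum_{j=0}^{m}t^{j}h_j(x,u,\dots,u_k),\qquad \lambda\in\mathbb{C},\quad m\le \dim S^{(k)}-1.$$
   Context: Here $u=u(x,t)$ is a scalar unknown, $u_l=\partial^l u/\partial x^l$ and $u_0\equiv u$. The quantities $x,t,u,u_1,u_2,\dots$ are treated as independent variables (jet coordinates). All functions are sufficiently smooth, each depends on finitely many of these variables, and functions are allowed to be complex-valued, so that $S$ and $S^{(k)}$ are complex vector spaces. Write $F=u_n+f(u,\dots,u_{n-1})$; thus $F$ does not depend explicitly on $x$ or $t$. The total $x$-derivative is $D=\frac{\partial}{\partial x}+\sum_{i\ge 0}u_{i+1}\frac{\partial}{\partial u_i}$. For a function $h(x,t,u,\dots,u_r)$ put $h_*=\sum_{i=0}^{r}\frac{\partial h}{\partial u_i}D^i$. The bracket is $\{h,r\}=h_*(r)-r_*(h)$. A symmetry of the equation $\partial u/\partial t=F$ is a function $G(x,t,u,u_1,\dots,u_k)$, for some finite $k$, such that the equation $\partial u/\partial\tau=G$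 is compatible with $\partial u/\partial t=F$; equivalently, $\partial G/\partial t=\{F,G\}$, where $\partial/\partial t$ is the partial derivative with respect to the explicit variable $t$. The order ${\rm ord}\,G$ is the largest $k$ such that $\partial G/\partial u_k\ne 0$. If $G$ does not depend on $u,u_1,\dots$, then ${\rm ord}\,G=0$. The equation is non-linearizable if there is no contact transformation taking it to a linear evolution equation. *)

theory Defs
  imports "HOL-Analysis.Analysis" "HOL-Library.Function_Algebras"
begin

text \<open>
  The real coordinates \<open>t, x, u = u\<^sub>0, u\<^sub>1, u\<^sub>2, \<dots>\<close> are \<open>Jt\<close>, \<open>Jx\<close>, \<open>Ju 0\<close>, \<open>Ju 1\<close> and so on.
  Sets of jets carry the product topology.
\<close>

datatype jvar = Jt | Jx | Ju nat

type_synonym jet = "jvar \<Rightarrow> real"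

definition pd :: "jvar \<Rightarrow> (jet \<Rightarrow> 'b::real_normed_vector) \<Rightarrow> jet \<Rightarrow> 'b" where
  "pd v h p = vector_derivative (\<lambda>s. h (p(v := s))) (at (p v))"

text \<open>For functions of finitely many coordinates on an open set, \<open>Ck_on k\<close> is the usual class
  of \<open>k\<close> times continuously differentiable functions.\<close>

primrec Ck_on :: "nat \<Rightarrow> jet set \<Rightarrow> (jet \<Rightarrow> 'b::real_normed_vector) \<Rightarrow> bool" where
  "Ck_on 0 \<Omega> h \<longleftrightarrow> continuous_on \<Omega> h"
| "Ck_on (Suc k) \<Omega> h \<longleftrightarrow> continuous_on \<Omega> h \<and>
     (\<forall>v. (\<forall>p\<in>\<Omega>. (\<lambda>s. h (p(v := s))) differentiable (at (p v))) \<and> Ck_on k \<Omega> (pd v h))"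

definition smooth_on :: "jet set \<Rightarrow> (jet \<Rightarrow> 'b::real_normed_vector) \<Rightarrow> bool" where
  "smooth_on \<Omega> h \<longleftrightarrow> (\<forall>k. Ck_on k \<Omega> h)"

definition depends_on :: "jet set \<Rightarrow> jvar set \<Rightarrow> (jet \<Rightarrow> 'b) \<Rightarrow> bool" where
  "depends_on \<Omega> A h \<longleftrightarrow> (\<forall>p\<in>\<Omega>. \<forall>q\<in>\<Omega>. (\<forall>v\<in>A. p v = q v) \<longrightarrow> h p = h q)"

definition jet_function :: "(jet \<Rightarrow> complex) \<Rightarrow> bool" where
  "jet_function h \<longleftrightarrow> smooth_on UNIV h \<and> (\<exists>A. finite A \<and> depends_on UNIV A h)"

text \<open>The sums below formally range over all \<open>i\<close>; they are restricted to the nonzero terms,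
  of which there are finitely many for functions of finitely many coordinates.\<close>

definition Dx :: "(jet \<Rightarrow> 'b::real_normed_vector) \<Rightarrow> jet \<Rightarrow> 'b" where
  "Dx h p = pd Jx h p + (\<Sum>i | pd (Ju i) h p \<noteq> 0. p (Ju (Suc i)) *\<^sub>R pd (Ju i) h p)"

definition frechet :: "(jet \<Rightarrow> complex) \<Rightarrow> (jet \<Rightarrow> complex) \<Rightarrow> jet \<Rightarrow> complex" where
  "frechet h r p = (\<Sum>i | pd (Ju i) h p \<noteq> 0. pd (Ju i) h p * (Dx ^^ i) r p)"

definition bracket :: "(jet \<Rightarrow> complex) \<Rightarrow> (jet \<Rightarrow> complex) \<Rightarrow> jet \<Rightarrow> complex" where
  "bracket h r p = frechet h r p - frechet r h p"

definition jet_ord :: "(jet \<Rightarrow> complex) \<Rightarrow> nat" where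
  "jet_ord G = Max (insert 0 {k. \<exists>p. pd (Ju k) G p \<noteq> 0})"

definition symmetries :: "(jet \<Rightarrow> complex) \<Rightarrow> (jet \<Rightarrow> complex) set" where
  "symmetries F = {G. jet_function G \<and> (\<forall>p. pd Jt G p = bracket F G p)}"

definition symmetries_le :: "(jet \<Rightarrow> complex) \<Rightarrow> nat \<Rightarrow> (jet \<Rightarrow> complex) set" where
  "symmetries_le F k = {G \<in> symmetries F. jet_ord G \<le> k}"

definition cscale :: "complex \<Rightarrow> (jet \<Rightarrow> complex) \<Rightarrow> jet \<Rightarrow> complex" where
  "cscale c h = (\<lambda>p. c * h p)"

interpretation jetfun: vector_space cscale
  by unfold_locales (auto simp: cscale_def fun_eq_iff algebra_simps)

definition finite_dimensional :: "(jet \<Rightarrow> complex) set \<Rightarrow> bool" where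
  "finite_dimensional V \<longleftrightarrow> (\<exists>B. finite B \<and> B \<subseteq> V \<and> V \<subseteq> jetfun.span B)"

definition evolution_rhs :: "nat \<Rightarrow> (jet \<Rightarrow> complex) \<Rightarrow> jet \<Rightarrow> complex" where
  "evolution_rhs n f p = of_real (p (Ju n)) + f p"

definition kdv_like :: "nat \<Rightarrow> (jet \<Rightarrow> complex) \<Rightarrow> bool" where
  "kdv_like n f \<longleftrightarrow> smooth_on UNIV f \<and> depends_on UNIV {Ju i |i. i < n} f \<and>
     (\<exists>c. \<forall>p. pd (Ju (n - 1)) f p = c)"

text \<open>
  A contact transformation is \<open>(t, x, u, u\<^sub>1) \<mapsto> (T(t), X, U, P)\<close>, where \<open>X\<close>, \<open>U\<close>, \<open>P\<close> are
  functions of \<open>t, x, u, u\<^sub>1\<close>; contact transformations between evolution equations of order at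
  least two are of this form. It is locally invertible on an open set \<open>\<Omega>\<close> of points
  \<open>(t, x, u, u\<^sub>1)\<close> (encoded as a cylinder in the space of jets), and it may be singular off \<open>\<Omega>\<close>,
  like the hodograph transformation at \<open>u\<^sub>1 = 0\<close>; density of \<open>\<Omega>\<close> means that it is
  defined at generic points. As \<open>u\<^sub>2\<close> is arbitrary, \<open>D(U) = P D(X)\<close> comprises both
  \<open>U\<^sub>x + u\<^sub>1 U\<^sub>u = P (X\<^sub>x + u\<^sub>1 X\<^sub>u)\<close> and \<open>\<partial>U/\<partial>u\<^sub>1 = P \<partial>X/\<partial>u\<^sub>1\<close>.
\<close>

definition contact_transformation ::
  "jet set \<Rightarrow> (jet \<Rightarrow> real) \<Rightarrow> (jet \<Rightarrow> real) \<Rightarrow> (jet \<Rightarrow> real) \<Rightarrow> (jet \<Rightarrow> real) \<Rightarrow> bool" where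
  "contact_transformation \<Omega> T X U P \<longleftrightarrow>
     open \<Omega> \<and> closure \<Omega> = UNIV \<and> depends_on UNIV {Jt, Jx, Ju 0, Ju 1} (\<lambda>p. p \<in> \<Omega>) \<and>
     smooth_on \<Omega> T \<and> depends_on \<Omega> {Jt} T \<and>
     (\<forall>h\<in>{X, U, P}. smooth_on \<Omega> h \<and> depends_on \<Omega> {Jt, Jx, Ju 0, Ju 1} h) \<and>
     (\<forall>p\<in>\<Omega>. Dx U p = P p * Dx X p) \<and>
     (\<forall>p\<in>\<Omega>. pd Jt T p \<noteq> 0 \<and>
        det (vector [vector [pd Jx X p, pd (Ju 0) X p, pd (Ju 1) X p],
                     vector [pd Jx U p, pd (Ju 0) U p, pd (Ju 1) U p],
                     vector [pd Jx P p, pd (Ju 0) P p, pd (Ju 1) P p]] :: real^3^3) \<noteq> 0)"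

text \<open>The transformed derivatives of \<open>u\<close>, meaningful where \<open>D(X) \<noteq> 0\<close>; the first one is \<open>P\<close>.\<close>

primrec prolong :: "(jet \<Rightarrow> real) \<Rightarrow> (jet \<Rightarrow> real) \<Rightarrow> nat \<Rightarrow> jet \<Rightarrow> real" where
  "prolong X U 0 = U"
| "prolong X U (Suc i) = (\<lambda>p. Dx (prolong X U i) p / Dx X p)"

fun prolonged :: "(jet \<Rightarrow> real) \<Rightarrow> (jet \<Rightarrow> real) \<Rightarrow> (jet \<Rightarrow> real) \<Rightarrow> jet \<Rightarrow> jet" where
  "prolonged T X U p Jt = T p"
| "prolonged T X U p Jx = X p"
| "prolonged T X U p (Ju i) = prolong X U i p"

text \<open>
  If \<open>w\<close> denotes the new unknown and \<open>w\<^sub>T = F'\<close> its equation, then differentiating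
  \<open>w(T, X) = U\<close> along a solution of \<open>u\<^sub>t = F\<close> gives
  \<open>F' T\<^sub>t + P (X\<^sub>t + X\<^sub>*(F)) = U\<^sub>t + U\<^sub>*(F)\<close>.
\<close>

definition takes_to ::
  "jet set \<Rightarrow> (jet \<Rightarrow> real) \<Rightarrow> (jet \<Rightarrow> real) \<Rightarrow> (jet \<Rightarrow> real) \<Rightarrow> (jet \<Rightarrow> real) \<Rightarrow>
   (jet \<Rightarrow> complex) \<Rightarrow> (jet \<Rightarrow> complex) \<Rightarrow> bool" where
  "takes_to \<Omega> T X U P F F' \<longleftrightarrow>
     (\<exists>V. open V \<and> smooth_on V F' \<and>
       (\<forall>p\<in>\<Omega>. Dx X p \<noteq> 0 \<longrightarrow>
          prolonged T X U p \<in> V \<and>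
          of_real (pd Jt U p) + frechet (\<lambda>q. of_real (U q)) F p
            - of_real (P p) * (of_real (pd Jt X p) + frechet (\<lambda>q. of_real (X q)) F p)
          = of_real (pd Jt T p) * F' (prolonged T X U p)))"

definition linear_rhs :: "(jet \<Rightarrow> complex) \<Rightarrow> bool" where
  "linear_rhs F \<longleftrightarrow> (\<exists>N a b. \<forall>p.
     F p = (\<Sum>i\<le>N. a i (p Jt) (p Jx) * of_real (p (Ju i))) + b (p Jt) (p Jx))"

definition linearizable :: "(jet \<Rightarrow> complex) \<Rightarrow> bool" where
  "linearizable F \<longleftrightarrow> (\<exists>\<Omega> T X U P F'.
     contact_transformation \<Omega> T X U P \<and> linear_rhs F' \<and> takes_to \<Omega> T X U P F F')"

definition quasipolynomial :: "nat \<Rightarrow> nat \<Rightarrow> (jet \<Rightarrow> complex) \<Rightarrow> bool" where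
  "quasipolynomial k m H \<longleftrightarrow> (\<exists>\<mu>::complex. \<exists>h :: nat \<Rightarrow> jet \<Rightarrow> complex.
     (\<forall>j\<le>m. smooth_on UNIV (h j) \<and> depends_on UNIV ({Jx} \<union> {Ju i |i. i \<le> k}) (h j)) \<and>
     (\<forall>p. H p = exp (\<mu> * of_real (p Jt)) * (\<Sum>j\<le>m. of_real (p Jt) ^ j * h j p)))"

end

theory Submission
  imports Defs
    "HOL-Computational_Algebra.Field_as_Ring"
    "HOL-Computational_Algebra.Polynomial_Factorial"
    "HOL-Computational_Algebra.Fundamental_Theorem_Algebra"
begin

text \<open>
  Applying \<open>\<partial>/\<partial>u\<^bsub>n+k-1\<^esub>\<close> to \<open>\<partial>G/\<partial>t = {F,G}\<close> for a symmetry \<open>G\<close> of order at most \<open>k\<close> gives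
  \<open>D(\<partial>G/\<partial>u\<^sub>k) = 0\<close>, so \<open>\<partial>G/\<partial>u\<^sub>k\<close> depends on \<open>t\<close> only. Hence \<open>\<partial>/\<partial>x\<close>, which preserves
  symmetries, lowers the order, and by rank-nullity the finiteness of \<open>dim S\<^sup>(\<^sup>k\<^sup>)\<close> reduces to two cases.

  For symmetries independent of \<open>x\<close> and of order \<open>k \<ge> n-1\<close>, applying \<open>\<partial>/\<partial>u\<^sub>k\<close> to the equation and
  evaluating at \<open>u\<^sub>1 = u\<^sub>2 = \<dots> = 0\<close>, where all total derivatives vanish, shows that \<open>\<partial>G/\<partial>u\<^sub>k\<close> is
  constant. Those of order at most \<open>n-2\<close> are, at each time, in a fixed finite-dimensional space of
  functions of \<open>u, u\<^sub>1, \<dots>\<close>, on which \<open>\<partial>G/\<partial>t = {F,G}\<close> is a linear system of ordinary differential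
  equations with constant coefficients; so they are determined by their values at \<open>t = 0\<close>.

  Symmetries \<open>b(t,x)\<close> satisfy \<open>b\<^sub>t = \<Sum>\<^sub>i (\<partial>F/\<partial>u\<^sub>i) \<partial>\<^sup>ib/\<partial>x\<^sup>i\<close>. If some \<open>\<partial>F/\<partial>u\<^sub>i\<close> is not constant,
  subtracting this equation at two points yields a polynomial in \<open>\<partial>/\<partial>x\<close> that annihilates all
  such \<open>b\<close>, and the eigenspaces of \<open>\<partial>/\<partial>x\<close> have dimension at most one. Otherwise \<open>F\<close> is affine, and
  the identity is a linearizing transformation. This is the only place where non-linearizability is used.

  The form of the symmetries is the decomposition of \<open>S\<^sup>(\<^sup>k\<^sup>)\<close> into generalized eigenspaces of \<open>\<partial>/\<partial>t\<close>.
\<close>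

subsection \<open>Smooth functions\<close>

text \<open>With the partial derivatives given explicitly, closure properties follow from ordinary
  derivative rules, without handling \<open>vector_derivative\<close>.\<close>

lemma Ck_on_SucI:
  assumes "continuous_on UNIV h"
    and "\<And>v p. ((\<lambda>s. h (p(v := s))) has_vector_derivative h' v p) (at (p v))"
    and "\<And>v. Ck_on k UNIV (h' v)"
  shows "Ck_on (Suc k) UNIV h"
proof -
  have "pd v h = h' v" for v
    unfolding pd_def by (rule ext) (simp add: assms(2) vector_derivative_at)
  then show ?thesis
    using assms by (auto intro: differentiableI_vector)
qed

lemma Ck_on_continuous: "Ck_on k UNIV h \<Longrightarrow> continuous_on UNIV h"
  by (cases k) auto

lemma Ck_on_Suc_derivative:
  assumes "Ck_on (Suc k) UNIV h"
  shows "((\<lambda>s. h (p(v := s))) has_vector_derivative pd v h p) (at (p v))"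
  using assms unfolding pd_def by (auto simp: vector_derivative_works[symmetric])

lemma Ck_on_SucD: "Ck_on (Suc k) UNIV h \<Longrightarrow> Ck_on k UNIV h"
  by (induction k arbitrary: h) auto

lemma Ck_on_add:
  "Ck_on k UNIV f \<Longrightarrow> Ck_on k UNIV g \<Longrightarrow> Ck_on k UNIV (\<lambda>p. f p + g p)"
proof (induction k arbitrary: f g)
  case 0
  then show ?case by (simp add: continuous_on_add continuous_on_mult)
next
  case (Suc k)
  show ?case
  proof (rule Ck_on_SucI)
    show "continuous_on UNIV (\<lambda>p. f p + g p)"
      using Suc.prems by (simp add: continuous_on_add continuous_on_mult)
    show "((\<lambda>s. f (p(v := s)) + g (p(v := s))) has_vector_derivative pd v f p + pd v g p) (at (p v))"
      for v p using Suc.prems by (intro derivative_intros Ck_on_Suc_derivative)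
    show "Ck_on k UNIV (\<lambda>p. pd v f p + pd v g p)" for v
      using Suc by simp
  qed
qed

lemma Ck_on_mult:
  fixes f g :: "jet \<Rightarrow> 'b::real_normed_algebra"
  shows "Ck_on k UNIV f \<Longrightarrow> Ck_on k UNIV g \<Longrightarrow> Ck_on k UNIV (\<lambda>p. f p * g p)"
proof (induction k arbitrary: f g)
  case 0
  then show ?case by (simp add: continuous_on_add continuous_on_mult)
next
  case (Suc k)
  show ?case
  proof (rule Ck_on_SucI)
    show "continuous_on UNIV (\<lambda>p. f p * g p)"
      using Suc.prems by (simp add: continuous_on_add continuous_on_mult)
    show "((\<lambda>s. f (p(v := s)) * g (p(v := s))) has_vector_derivative f p * pd v g p + pd v f p * g p)
        (at (p v))" for v p
    proof -
      have "((\<lambda>s. f (p(v := s)) * g (p(v := s))) has_vector_derivative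
          f (p(v := p v)) * pd v g p + pd v f p * g (p(v := p v))) (at (p v))"
        using Suc.prems by (intro has_vector_derivative_mult Ck_on_Suc_derivative)
      then show ?thesis by simp
    qed
    show "Ck_on k UNIV (\<lambda>p. f p * pd v g p + pd v f p * g p)" for v
      using Suc Ck_on_SucD by (intro Ck_on_add Suc.IH) auto
  qed
qed

lemma Ck_on_const: "Ck_on k UNIV (\<lambda>p. c)"
proof (induction k arbitrary: c)
  case (Suc k)
  show ?case
    by (rule Ck_on_SucI[where h' = "\<lambda>v p. 0"]) (use Suc in auto)
qed auto

lemma pd_coordinate:
  "pd v (\<lambda>p. of_real (p w)) = (\<lambda>p. of_bool (v = w) :: 'b::real_normed_algebra_1)"
proof (rule ext)
  fix p
  have "((\<lambda>s. of_real ((p(v := s)) w)) has_vector_derivative (of_bool (v = w) :: 'b)) (at (p v))"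
    by (cases "v = w") (auto intro!: derivative_eq_intros simp: has_vector_derivative_of_real)
  then show "pd v (\<lambda>p. of_real (p w)) p = (of_bool (v = w) :: 'b)"
    unfolding pd_def by (rule vector_derivative_at)
qed

lemma continuous_on_coordinate: "continuous_on UNIV (\<lambda>p::jet. p w)"
  by (rule continuous_on_product_coordinates)

lemma smooth_on_coordinate: "smooth_on UNIV (\<lambda>p. of_real (p w) :: 'b::real_normed_algebra_1)"
proof -
  have "Ck_on k UNIV (\<lambda>p. of_real (p w) :: 'b)" for k
  proof (cases k)
    case (Suc k')
    show ?thesis
      unfolding Suc
    proof (rule Ck_on_SucI[where h' = "\<lambda>v p. of_bool (v = w)"])
      show "continuous_on UNIV (\<lambda>p::jet. of_real (p w) :: 'b)"
        by (intro continuous_on_of_real continuous_on_coordinate)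
      show "((\<lambda>s. of_real ((p(v := s)) w)) has_vector_derivative (of_bool (v = w) :: 'b)) (at (p v))"
        for v and p :: jet
        by (cases "v = w") (auto intro!: derivative_eq_intros simp: has_vector_derivative_of_real)
    qed (rule Ck_on_const)
  qed (auto intro!: continuous_on_of_real continuous_on_coordinate)
  then show ?thesis by (simp add: smooth_on_def)
qed

lemma smooth_on_has_pd:
  assumes "smooth_on UNIV h"
  shows "((\<lambda>s. h (p(v := s))) has_vector_derivative pd v h (p(v := s))) (at s)"
  using Ck_on_Suc_derivative[of 0 h "p(v := s)" v] assms by (simp add: smooth_on_def del: Ck_on.simps)

lemma smooth_on_continuous: "smooth_on UNIV h \<Longrightarrow> continuous_on UNIV h"
  unfolding smooth_on_def using Ck_on_continuous by blast

lemma smooth_on_pd: "smooth_on UNIV h \<Longrightarrow> smooth_on UNIV (pd v h)"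
  unfolding smooth_on_def by (meson Ck_on.simps(2))

text \<open>Applied to \<open>Re\<close> and \<open>Im\<close>, this reduces the symmetry of second
  derivatives to real functions, for which the mean value theorem is available.\<close>

lemma smooth_on_bounded_linear:
  assumes "smooth_on UNIV h" and "bounded_linear L"
  shows "smooth_on UNIV (\<lambda>p. L (h p))" and "pd v (\<lambda>p. L (h p)) = (\<lambda>p. L (pd v h p))"
proof -
  interpret bounded_linear L by fact
  have der: "((\<lambda>s. L (h (p(v := s)))) has_vector_derivative L (pd v h p)) (at (p v))"
    if "smooth_on UNIV h" for h p v
    using smooth_on_has_pd[OF that, of p v "p v"] has_vector_derivative by fastforce
  have "Ck_on k UNIV (\<lambda>p. L (h p))" if "smooth_on UNIV h" for k h
    using that
  proof (induction k arbitrary: h)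
    case 0
    then show ?case by (auto intro!: continuous_on dest: smooth_on_continuous)
  next
    case (Suc k)
    show ?case
      by (rule Ck_on_SucI[where h' = "\<lambda>v p. L (pd v h p)"])
        (use Suc smooth_on_pd der in \<open>auto intro!: continuous_on dest: smooth_on_continuous simp del: fun_upd_apply\<close>)
  qed
  then show "smooth_on UNIV (\<lambda>p. L (h p))" using assms by (simp add: smooth_on_def)
  show "pd v (\<lambda>p. L (h p)) = (\<lambda>p. L (pd v h p))"
    by (rule ext) (subst pd_def, rule vector_derivative_at[OF der[OF assms(1)]])
qed

section \<open>Symmetry of second partial derivatives\<close>

text \<open>The mean value theorem is applied twice: to \<open>h (q s e) - h (q s 0)\<close> as a
  function of \<open>s\<close>, then to \<open>pd v h (q s r)\<close> as a function of
  \<open>r\<close>.\<close>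

lemma mixed_difference_mean_value:
  fixes h :: "jet \<Rightarrow> real" and p :: jet
  assumes "smooth_on UNIV h" "v \<noteq> w" "e > 0"
  defines "q \<equiv> \<lambda>s r. p(v := p v + s, w := p w + r)"
  shows "\<exists>s r. 0 < s \<and> s < e \<and> 0 < r \<and> r < e \<and>
    h (q e e) - h (q e 0) - h (q 0 e) + h (q 0 0) = e * e * pd w (pd v h) (q s r)"
proof -
  have q_v: "((\<lambda>s. g (q s r)) has_real_derivative pd v g (q s r)) (at s)"
    if "smooth_on UNIV g" for g r s
  proof -
    have "((\<lambda>s. g ((p(w := p w + r))(v := s))) has_real_derivative pd v g (q s r)) (at (p v + s))"
      using smooth_on_has_pd[OF that, of "p(w := p w + r)" v "p v + s"] assms(2)
      by (simp add: has_real_derivative_iff_has_vector_derivative q_def fun_upd_twist)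
    from DERIV_shift[THEN iffD1, OF this[unfolded add.commute[of "p v" s]]] show ?thesis
      using assms(2) by (simp add: q_def fun_upd_twist add.commute)
  qed
  have q_w: "((\<lambda>r. g (q s r)) has_real_derivative pd w g (q s r)) (at r)"
    if "smooth_on UNIV g" for g r s
  proof -
    have "((\<lambda>r. g ((p(v := p v + s))(w := r))) has_real_derivative pd w g (q s r)) (at (p w + r))"
      using smooth_on_has_pd[OF that, of "p(v := p v + s)" w "p w + r"]
      by (simp add: has_real_derivative_iff_has_vector_derivative q_def)
    from DERIV_shift[THEN iffD1, OF this[unfolded add.commute[of "p w" r]]] show ?thesis
      by (simp add: q_def add.commute)
  qed
  have "\<exists>s>0. s < e \<and> (h (q e e) - h (q e 0)) - (h (q 0 e) - h (q 0 0)) =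
      (e - 0) * (pd v h (q s e) - pd v h (q s 0))"
    by (rule MVT2[OF assms(3)]) (intro derivative_intros q_v assms(1))
  then obtain s where s: "s > 0" "s < e" "h (q e e) - h (q e 0) - (h (q 0 e) - h (q 0 0)) =
      e * (pd v h (q s e) - pd v h (q s 0))"
    by auto
  have "\<exists>r>0. r < e \<and> pd v h (q s e) - pd v h (q s 0) = (e - 0) * pd w (pd v h) (q s r)"
    by (rule MVT2[OF assms(3)]) (intro q_w smooth_on_pd assms(1))
  then obtain r where "r > 0" "r < e" "pd v h (q s e) - pd v h (q s 0) = e * pd w (pd v h) (q s r)"
    by auto
  with s show ?thesis by (intro exI[of _ s] exI[of _ r]) (simp add: algebra_simps)
qed

text \<open>The second difference is symmetric in \<open>v\<close> and \<open>w\<close>. Hence the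
  two mixed derivatives take equal values at points arbitrarily close to \<open>p\<close>, and
  continuity gives equality at \<open>p\<close>.\<close>

lemma pd_commute_real:
  fixes h :: "jet \<Rightarrow> real"
  assumes "smooth_on UNIV h"
  shows "pd v (pd w h) = pd w (pd v h)"
proof (rule ext, cases "v = w")
  fix p :: jet
  assume "v \<noteq> w"
  define q where "q = (\<lambda>s r. p(v := p v + s, w := p w + r))"
  have q_eq: "q s r = p(w := p w + r, v := p v + s)" for s r
    using \<open>v \<noteq> w\<close> by (auto simp: q_def)
  \<comment> \<open>Only the two-parameter slice through \<open>p\<close> matters, so continuity in
    the product topology is transported to the plane.\<close>
  have cont: "continuous_on UNIV (\<lambda>x. g (q (fst x) (snd x)))" if "smooth_on UNIV g" for g :: "jet \<Rightarrow> real"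
  proof (rule continuous_on_compose2[OF smooth_on_continuous[OF that]])
    show "continuous_on UNIV (\<lambda>x. q (fst x) (snd x))"
    proof (rule continuous_on_coordinatewise_then_product)
      show "continuous_on UNIV (\<lambda>x. q (fst x) (snd x) i)" for i
        by (cases "i = v"; cases "i = w") (auto simp: q_def intro!: continuous_intros)
    qed
  qed auto
  have lim: "\<exists>d>0. \<forall>s r. 0 < s \<and> s < d \<and> 0 < r \<and> r < d \<longrightarrow> \<bar>g (q s r) - g p\<bar> < e"
    if sm: "smooth_on UNIV g" and e: "e > 0" for g :: "jet \<Rightarrow> real" and e
  proof -
    have "isCont (\<lambda>x. g (q (fst x) (snd x))) (0, 0)"
      using cont[OF sm] by (simp add: continuous_on_eq_continuous_at)
    then obtain d where d: "d > 0" "\<And>x. dist x (0, 0) < d \<Longrightarrow> dist (g (q (fst x) (snd x))) (g (q 0 0)) < e"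
      using e by (auto simp: continuous_at_eps_delta)
    have "\<bar>g (q s r) - g p\<bar> < e" if "0 < s" "s < d/2" "0 < r" "r < d/2" for s r
    proof -
      have "dist (s, r) (0, 0) \<le> \<bar>s\<bar> + \<bar>r\<bar>"
        using sqrt_sum_squares_le_sum_abs[of s r] by (simp add: dist_Pair_Pair)
      then have "dist (s, r) (0, 0) < d" using that by simp
      from d(2)[OF this] show ?thesis by (simp add: dist_real_def q_def)
    qed
    then show ?thesis using d(1) by (intro exI[of _ "d/2"]) auto
  qed
  show "pd v (pd w h) p = pd w (pd v h) p"
  proof (rule ccontr)
    assume ne: "pd v (pd w h) p \<noteq> pd w (pd v h) p"
    define e where "e = \<bar>pd v (pd w h) p - pd w (pd v h) p\<bar> / 2"
    have "e > 0" using ne by (simp add: e_def)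
    obtain d1 where d1: "d1 > 0" "\<And>s r. 0 < s \<Longrightarrow> s < d1 \<Longrightarrow> 0 < r \<Longrightarrow> r < d1 \<Longrightarrow>
        \<bar>pd v (pd w h) (q s r) - pd v (pd w h) p\<bar> < e"
      using lim[OF smooth_on_pd[OF smooth_on_pd[OF assms]] \<open>e > 0\<close>] by metis
    obtain d2 where d2: "d2 > 0" "\<And>s r. 0 < s \<Longrightarrow> s < d2 \<Longrightarrow> 0 < r \<Longrightarrow> r < d2 \<Longrightarrow>
        \<bar>pd w (pd v h) (q s r) - pd w (pd v h) p\<bar> < e"
      using lim[OF smooth_on_pd[OF smooth_on_pd[OF assms]] \<open>e > 0\<close>] by metis
    define d where "d = min d1 d2 / 2"
    have d: "d > 0" "d < d1" "d < d2" using d1(1) d2(1) by (auto simp: d_def)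
    obtain s r where sr: "0 < s" "s < d" "0 < r" "r < d"
      "h (q d d) - h (q d 0) - h (q 0 d) + h (q 0 0) = d * d * pd w (pd v h) (q s r)"
      using mixed_difference_mean_value[OF assms \<open>v \<noteq> w\<close> d(1), of p] by (auto simp: q_def)
    obtain r' s' where sr': "0 < s'" "s' < d" "0 < r'" "r' < d"
      "h (q d d) - h (q 0 d) - h (q d 0) + h (q 0 0) = d * d * pd v (pd w h) (q s' r')"
      using mixed_difference_mean_value[OF assms \<open>v \<noteq> w\<close>[symmetric] d(1), of p]
      by (auto simp: q_eq)
    have "d * d * pd w (pd v h) (q s r) = d * d * pd v (pd w h) (q s' r')"
      using sr(5) sr'(5) by linarith
    then have "pd w (pd v h) (q s r) = pd v (pd w h) (q s' r')"
      using d(1) by simp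
    moreover have "\<bar>pd w (pd v h) (q s r) - pd w (pd v h) p\<bar> < e"
      using d2(2) sr d by auto
    moreover have "\<bar>pd v (pd w h) (q s' r') - pd v (pd w h) p\<bar> < e"
      using d1(2) sr' d by auto
    moreover have "2 * e = \<bar>pd v (pd w h) p - pd w (pd v h) p\<bar>"
      by (simp add: e_def)
    ultimately show False by (smt (verit))
  qed
qed simp

lemma pd_commute:
  fixes h :: "jet \<Rightarrow> complex"
  assumes h: "smooth_on UNIV h"
  shows "pd v (pd w h) = pd w (pd v h)"
proof -
  have "L (pd v (pd w h) p) = L (pd w (pd v h) p)" if L: "bounded_linear L" for L :: "complex \<Rightarrow> real" and p
  proof -
    have "pd a (pd b (\<lambda>p. L (h p))) = (\<lambda>p. L (pd a (pd b h) p))" for a b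
      by (simp add: smooth_on_bounded_linear(2)[OF h L] smooth_on_bounded_linear(2)[OF smooth_on_pd[OF h] L])
    then show ?thesis
      using pd_commute_real[OF smooth_on_bounded_linear(1)[OF h L], of v w] by metis
  qed
  from this[OF bounded_linear_Re] this[OF bounded_linear_Im] show ?thesis
    by (auto simp: complex_eq_iff)
qed

subsection \<open>Jet functions\<close>

lemma sum_fun_apply [simp]: "(\<Sum>i\<in>A. f i) x = (\<Sum>i\<in>A. f i x)"
  by (induction A rule: infinite_finite_induct) auto

lemma depends_onD: "depends_on UNIV A h \<Longrightarrow> (\<And>v. v \<in> A \<Longrightarrow> p v = q v) \<Longrightarrow> h p = h q"
  unfolding depends_on_def by blast

lemma pd_eq_0_if_independent:
  assumes "depends_on UNIV A h" "v \<notin> A"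
  shows "pd v h = 0"
proof
  fix p
  have "(\<lambda>s. h (p(v := s))) = (\<lambda>s. h p)"
    using assms by (intro ext) (auto simp: depends_on_def)
  then show "pd v h p = 0 p" by (simp add: pd_def)
qed

lemma depends_on_pd:
  assumes "depends_on UNIV A h"
  shows "depends_on UNIV A (pd v h)"
proof (cases "v \<in> A")
  case True
  have "pd v h p = pd v h q" if "\<forall>w\<in>A. p w = q w" for p q
  proof -
    have "h (p(v := s)) = h (q(v := s))" for s
      using assms that by (auto simp: depends_on_def)
    then show ?thesis using that True by (simp add: pd_def)
  qed
  then show ?thesis by (auto simp: depends_on_def)
next
  case False
  then show ?thesis using pd_eq_0_if_independent[OF assms] by (simp add: depends_on_def)
qed

lemma jet_function_smooth: "jet_function h \<Longrightarrow> smooth_on UNIV h"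
  by (simp add: jet_function_def)

lemma jet_function_pd [simp, intro]: "jet_function h \<Longrightarrow> jet_function (pd v h)"
  unfolding jet_function_def using smooth_on_pd depends_on_pd by blast

lemma jet_function_binary:
  assumes "jet_function f" "jet_function g" "smooth_on UNIV (\<lambda>p. op (f p) (g p))"
  shows "jet_function (\<lambda>p. op (f p) (g p))"
proof -
  obtain A B where AB: "finite A" "depends_on UNIV A f" "finite B" "depends_on UNIV B g"
    using assms by (auto simp: jet_function_def)
  have "f p = f q \<and> g p = g q" if "\<forall>v\<in>A \<union> B. p v = q v" for p q
    using AB that by (simp add: depends_on_def)
  then have "depends_on UNIV (A \<union> B) (\<lambda>p. op (f p) (g p))"
    unfolding depends_on_def by metis
  then show ?thesis using AB assms(3) unfolding jet_function_def by blast
qed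

lemma jet_function_add [simp, intro]:
  "jet_function f \<Longrightarrow> jet_function g \<Longrightarrow> jet_function (f + g)"
  using jet_function_binary[of f g "(+)"] jet_function_smooth[of f] jet_function_smooth[of g]
  by (simp add: smooth_on_def Ck_on_add plus_fun_def)

lemma jet_function_mult [simp, intro]:
  "jet_function f \<Longrightarrow> jet_function g \<Longrightarrow> jet_function (f * g)"
  using jet_function_binary[of f g "(*)"] jet_function_smooth[of f] jet_function_smooth[of g]
  by (simp add: smooth_on_def Ck_on_mult times_fun_def)

lemma jet_function_const [simp, intro]: "jet_function (\<lambda>p. c)"
  by (auto simp: jet_function_def depends_on_def smooth_on_def Ck_on_const)

lemma jet_function_0 [simp, intro]: "jet_function 0"
  using jet_function_const[of 0] by (simp add: zero_fun_def)

lemma jet_function_of_real_coordinate [simp, intro]: "jet_function (\<lambda>p. of_real (p v))"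
  unfolding jet_function_def
  by (auto simp: smooth_on_coordinate depends_on_def intro!: exI[of _ "{v}"])

lemma cscale_conv_mult: "cscale c h = (\<lambda>p. c) * h"
  by (simp add: cscale_def fun_eq_iff)

lemma depends_on_cscale:
  assumes "depends_on UNIV A h"
  shows "depends_on UNIV A (cscale c h)"
  unfolding depends_on_def
proof (intro ballI impI)
  fix p q :: jet
  assume "\<forall>v\<in>A. p v = q v"
  then have "h p = h q" by (intro depends_onD[OF assms]) blast
  then show "cscale c h p = cscale c h q" by (simp add: cscale_def)
qed

lemma jet_function_cscale [simp, intro]: "jet_function h \<Longrightarrow> jet_function (cscale c h)"
  by (simp add: cscale_conv_mult)

lemma jet_function_uminus [simp, intro]: "jet_function h \<Longrightarrow> jet_function (- h)"
  using jet_function_cscale[of h "-1"] by (simp add: cscale_def fun_Compl_def)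

lemma jet_function_diff [simp, intro]:
  "jet_function f \<Longrightarrow> jet_function g \<Longrightarrow> jet_function (f - g)"
  using jet_function_add[of f "- g"] by simp

lemma jet_function_sum [simp, intro]:
  "(\<And>i. i \<in> A \<Longrightarrow> jet_function (f i)) \<Longrightarrow> jet_function (\<Sum>i\<in>A. f i)"
  by (induction A rule: infinite_finite_induct) auto

lemma has_pd: "jet_function h \<Longrightarrow>
    ((\<lambda>s. h (p(v := s))) has_vector_derivative pd v h (p(v := s))) (at s)"
  by (simp add: smooth_on_has_pd jet_function_smooth)

lemma pd_eqI:
  assumes "\<And>p. ((\<lambda>s. h (p(v := s))) has_vector_derivative h' p) (at (p v))"
  shows "pd v h = h'"
  unfolding pd_def by (rule ext) (simp add: assms vector_derivative_at)

lemma pd_add [simp]: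
  assumes "jet_function f" "jet_function g"
  shows "pd v (f + g) = pd v f + pd v g"
proof (rule pd_eqI)
  show "((\<lambda>s. (f + g) (p(v := s))) has_vector_derivative (pd v f + pd v g) p) (at (p v))" for p
    using has_vector_derivative_add[OF has_pd[OF assms(1), of p v "p v"] has_pd[OF assms(2), of p v "p v"]]
    by simp
qed

lemma pd_mult [simp]:
  assumes "jet_function f" "jet_function g"
  shows "pd v (f * g) = f * pd v g + pd v f * g"
proof (rule pd_eqI)
  show "((\<lambda>s. (f * g) (p(v := s))) has_vector_derivative (f * pd v g + pd v f * g) p) (at (p v))" for p
    using has_vector_derivative_mult[OF has_pd[OF assms(1), of p v "p v"] has_pd[OF assms(2), of p v "p v"]]
    by simp
qed

lemma pd_const [simp]: "pd v (\<lambda>p. c) = 0"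
  by (rule pd_eqI) simp

lemma pd_0 [simp]: "pd v 0 = 0"
  unfolding zero_fun_def by (rule pd_const[unfolded zero_fun_def])

lemma pd_cscale [simp]: "jet_function h \<Longrightarrow> pd v (cscale c h) = cscale c (pd v h)"
  by (simp add: cscale_conv_mult)

lemma pd_uminus [simp]: "jet_function h \<Longrightarrow> pd v (- h) = - pd v h"
  using pd_cscale[of h v "-1"] by (simp add: cscale_def fun_Compl_def)

lemma pd_diff [simp]: "jet_function f \<Longrightarrow> jet_function g \<Longrightarrow> pd v (f - g) = pd v f - pd v g"
  using pd_add[of f "- g" v] by simp

lemma pd_sum [simp]:
  "(\<And>i. i \<in> A \<Longrightarrow> jet_function (f i)) \<Longrightarrow> pd v (\<Sum>i\<in>A. f i) = (\<Sum>i\<in>A. pd v (f i))"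
  by (induction A rule: infinite_finite_induct) auto

lemma pd_commute_jet: "jet_function h \<Longrightarrow> pd v (pd w h) = pd w (pd v h)"
  by (simp add: pd_commute jet_function_smooth)

lemma constant_along_if_pd_eq_0:
  assumes "jet_function h" "pd v h = 0"
  shows "h (p(v := s)) = h p"
proof -
  have "\<exists>c. \<forall>s\<in>UNIV. h (p(v := s)) = c"
    using has_vector_derivative_zero_constant[of UNIV "\<lambda>s. h (p(v := s))"]
      has_pd[OF assms(1), of p v] assms(2)
    by (metis convex_UNIV zero_fun_apply)
  then show ?thesis by (metis UNIV_I fun_upd_triv)
qed

text \<open>Converse of \<open>pd_eq_0_if_independent\<close>. A jet function depends on a finite
  set \<open>A\<close> only, so it is enough to change the finitely many coordinates in
  \<open>A - B\<close>, one at a time.\<close>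

lemma depends_on_if_pd_eq_0:
  assumes "jet_function h" "\<And>v. v \<notin> B \<Longrightarrow> pd v h = 0"
  shows "depends_on UNIV B h"
  unfolding depends_on_def
proof (intro ballI impI)
  fix p q :: jet
  assume eq: "\<forall>v\<in>B. p v = q v"
  obtain A where A: "finite A" "depends_on UNIV A h"
    using assms by (auto simp: jet_function_def)
  have "h (override_on p q C) = h p" if "finite C" "C \<inter> B = {}" for C
    using that
  proof (induction C rule: finite_induct)
    case (insert v C)
    have "override_on p q (insert v C) = (override_on p q C)(v := q v)"
      by (auto simp: override_on_def)
    then show ?case
      using insert constant_along_if_pd_eq_0[OF assms(1) assms(2)[of v]] by (auto simp del: fun_upd_apply)
  qed simp
  from this[of "A - B"] A have "h (override_on p q (A - B)) = h p"
    by auto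
  moreover have "h (override_on p q (A - B)) = h q"
    using A(2) eq unfolding depends_on_def by (auto simp: override_on_def)
  ultimately show "h p = h q" by simp
qed

lemma constant_if_pd_eq_0:
  assumes "jet_function h" "\<And>v. pd v h = 0"
  shows "h p = h q"
  using depends_on_if_pd_eq_0[of h "{}"] assms by (auto simp: depends_on_def)

subsection \<open>The total derivative\<close>

text \<open>The bound is strict so that \<open>ord_less h 0\<close> can express independence of all
  u_i, which \<open>jet_ord\<close> does not distinguish from order 0 with u_0 present.\<close>

definition ord_less :: "(jet \<Rightarrow> complex) \<Rightarrow> nat \<Rightarrow> bool" where
  "ord_less h N \<longleftrightarrow> (\<forall>i\<ge>N. pd (Ju i) h = 0)"

lemma ord_lessD: "ord_less h N \<Longrightarrow> N \<le> i \<Longrightarrow> pd (Ju i) h = 0"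
  by (simp add: ord_less_def)

lemma ord_less_mono: "ord_less h N \<Longrightarrow> N \<le> M \<Longrightarrow> ord_less h M"
  by (simp add: ord_less_def)

lemma ord_less_SucD: "ord_less h (Suc k) \<Longrightarrow> pd (Ju k) h = 0 \<Longrightarrow> ord_less h k"
  unfolding ord_less_def by (metis le_eq_less_or_eq Suc_leI)

lemma ord_less_exists:
  assumes "jet_function h"
  obtains N where "ord_less h N"
proof -
  obtain A where A: "finite A" "depends_on UNIV A h"
    using assms by (auto simp: jet_function_def)
  have "finite (Ju -` A)" using A(1) by (intro finite_vimageI) (auto simp: inj_on_def)
  then obtain N where N: "\<And>i. i \<in> Ju -` A \<Longrightarrow> i < N"
    by (auto simp: finite_nat_set_iff_bounded)
  have "pd (Ju i) h = 0" if "N \<le> i" for i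
    using N[of i] that by (intro pd_eq_0_if_independent[OF A(2)]) auto
  then have "ord_less h N" by (simp add: ord_less_def)
  then show ?thesis by (rule that)
qed

definition ucoord :: "nat \<Rightarrow> jet \<Rightarrow> complex" where
  "ucoord i = (\<lambda>p. of_real (p (Ju i)))"

lemma jet_function_ucoord [simp, intro]: "jet_function (ucoord i)"
  by (simp add: ucoord_def)

lemma pd_ucoord [simp]: "pd v (ucoord i) = (\<lambda>p. of_bool (v = Ju i))"
  by (simp add: ucoord_def pd_coordinate)

text \<open>The sums defining \<open>Dx\<close> and \<open>frechet\<close> have index sets that vary
  with the point; a uniform range is needed before they can be differentiated or added.\<close>

lemma nonzero_sum_eq_bounded_sum:
  fixes f :: "nat \<Rightarrow> 'b::comm_monoid_add"
  assumes "\<And>i. N \<le> i \<Longrightarrow> g i = 0" "\<And>i. g i = 0 \<Longrightarrow> f i = 0"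
  shows "(\<Sum>i | g i \<noteq> (0::'c::zero). f i) = (\<Sum>i<N. f i)"
proof (rule sum.mono_neutral_left)
  show "{i. g i \<noteq> 0} \<subseteq> {..<N}" using assms(1) by (metis (mono_tags) lessThan_iff mem_Collect_eq not_le subsetI)
qed (use assms(2) in auto)

lemma Dx_eq:
  assumes "ord_less h N"
  shows "Dx h = pd Jx h + (\<Sum>i<N. ucoord (Suc i) * pd (Ju i) h)"
proof
  fix p
  have "(\<Sum>i | pd (Ju i) h p \<noteq> 0. p (Ju (Suc i)) *\<^sub>R pd (Ju i) h p)
      = (\<Sum>i<N. p (Ju (Suc i)) *\<^sub>R pd (Ju i) h p)"
    by (rule nonzero_sum_eq_bounded_sum) (use ord_lessD[OF assms] in auto)
  then show "Dx h p = (pd Jx h + (\<Sum>i<N. ucoord (Suc i) * pd (Ju i) h)) p"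
    by (simp add: Dx_def ucoord_def scaleR_conv_of_real)
qed

lemma jet_function_Dx [simp, intro]:
  assumes "jet_function h"
  shows "jet_function (Dx h)"
  using ord_less_exists[OF assms] Dx_eq assms by (metis (no_types, lifting) jet_function_add
    jet_function_mult jet_function_pd jet_function_sum jet_function_ucoord)

lemma jet_function_Dx_pow [simp, intro]: "jet_function h \<Longrightarrow> jet_function ((Dx ^^ i) h)"
  by (induction i) auto

text \<open>This is the commutator of \<open>pd (Ju j)\<close> with \<open>Dx\<close> (see
  \<open>pd_Dx\<close>): u_j is the coefficient of \<open>pd (Ju (j - 1))\<close> in
  \<open>Dx\<close>, while u_0 is no coefficient there.\<close>

definition pd_pred :: "nat \<Rightarrow> (jet \<Rightarrow> complex) \<Rightarrow> jet \<Rightarrow> complex" where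
  "pd_pred j h = (case j of 0 \<Rightarrow> 0 | Suc i \<Rightarrow> pd (Ju i) h)"

text \<open>Partial derivatives commute with each other, so the only extra term comes from
  differentiating the coefficients u_{i+1} of \<open>Dx\<close>.\<close>

lemma pd_Dx:
  assumes h: "jet_function h"
  shows "pd v (Dx h) = Dx (pd v h) + (case v of Ju j \<Rightarrow> pd_pred j h | _ \<Rightarrow> 0)"
proof -
  obtain N0 where "ord_less h N0" using ord_less_exists[OF h] .
  obtain N1 where "ord_less (pd v h) N1" using ord_less_exists[of "pd v h"] h by auto
  \<comment> \<open>With \<open>N\<close> at least \<open>j\<close>, the index \<open>j - 1\<close>
    of the extra term occurs in the sum.\<close>
  define N where "N = max (max N0 N1) (case v of Ju j \<Rightarrow> j | _ \<Rightarrow> 0)"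
  have N: "ord_less h N" "ord_less (pd v h) N"
    using \<open>ord_less h N0\<close> \<open>ord_less (pd v h) N1\<close> by (auto simp: N_def elim: ord_less_mono)
  have "(\<Sum>i<N. (\<lambda>p. of_bool (v = Ju (Suc i))) * pd (Ju i) h)
      = (case v of Ju j \<Rightarrow> pd_pred j h | _ \<Rightarrow> 0)"
  proof (cases v)
    case (Ju j)
    show ?thesis
    proof (cases j)
      case 0
      then show ?thesis using Ju by (simp add: pd_pred_def zero_fun_def fun_eq_iff)
    next
      case (Suc i)
      then have "i < N" using Ju by (auto simp: N_def)
      have "(\<Sum>i'<N. (\<lambda>p. of_bool (v = Ju (Suc i'))) * pd (Ju i') h)
          = (\<Sum>i'<N. if i' = i then pd (Ju i) h else 0)"
        using Ju Suc by (intro sum.cong) (auto simp: fun_eq_iff)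
      also have "\<dots> = pd (Ju i) h" using \<open>i < N\<close> by simp
      finally show ?thesis using Ju Suc by (simp add: pd_pred_def)
    qed
  qed (simp_all add: fun_eq_iff)
  moreover have "pd v (Dx h) = pd Jx (pd v h) +
     (\<Sum>i<N. ucoord (Suc i) * pd (Ju i) (pd v h)) + (\<Sum>i<N. (\<lambda>p. of_bool (v = Ju (Suc i))) * pd (Ju i) h)"
    using h by (simp add: Dx_eq[OF N(1)] pd_commute_jet[OF h, of v] sum.distrib add.assoc)
  ultimately show ?thesis
    by (simp only: Dx_eq[OF N(2)])
qed

lemma Dx_add [simp]:
  assumes "jet_function f" "jet_function g"
  shows "Dx (f + g) = Dx f + Dx g"
proof -
  obtain N0 where N0: "ord_less f N0" using ord_less_exists[OF assms(1)] .
  obtain N1 where N1: "ord_less g N1" using ord_less_exists[OF assms(2)] .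
  define N where "N = max N0 N1"
  have N: "ord_less f N" "ord_less g N" using N0 N1 by (auto simp: N_def elim: ord_less_mono)
  then have "ord_less (f + g) N" using assms by (simp add: ord_less_def)
  from Dx_eq[OF this] Dx_eq[OF N(1)] Dx_eq[OF N(2)] assms show ?thesis
    by (simp add: sum.distrib algebra_simps)
qed

lemma Dx_cscale [simp]:
  assumes "jet_function h"
  shows "Dx (cscale c h) = cscale c (Dx h)"
proof -
  obtain N where N: "ord_less h N" using ord_less_exists[OF assms] .
  then have "ord_less (cscale c h) N" using assms by (simp add: ord_less_def cscale_conv_mult)
  from Dx_eq[OF this] Dx_eq[OF N] assms show ?thesis
    by (simp add: cscale_conv_mult algebra_simps sum_distrib_left)
qed

lemma Dx_0 [simp]: "Dx 0 = (0 :: jet \<Rightarrow> complex)"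
  using Dx_cscale[of 0 0] by (simp add: cscale_def zero_fun_def)

lemma Dx_pow_add: "jet_function f \<Longrightarrow> jet_function g \<Longrightarrow> (Dx ^^ i) (f + g) = (Dx ^^ i) f + (Dx ^^ i) g"
  by (induction i) auto

lemma Dx_pow_cscale: "jet_function h \<Longrightarrow> (Dx ^^ i) (cscale c h) = cscale c ((Dx ^^ i) h)"
  by (induction i) auto

lemma pd_Dx_pow:
  assumes "jet_function h" "v \<in> {Jt, Jx}"
  shows "pd v ((Dx ^^ i) h) = (Dx ^^ i) (pd v h)"
  using assms by (induction i) (auto simp: pd_Dx)

lemma ord_less_Dx_pow:
  assumes "jet_function h" "ord_less h N"
  shows "ord_less ((Dx ^^ i) h) (N + i)"
proof (induction i)
  case (Suc i)
  have "pd (Ju j) (Dx ((Dx ^^ i) h)) = 0" if j_ge: "j \<ge> N + Suc i" for j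
  proof -
    obtain j' where j: "j = Suc j'" "j' \<ge> N + i" using j_ge by (cases j) auto
    then show ?thesis
      using Suc assms by (simp add: pd_Dx pd_pred_def ord_less_def)
  qed
  then show ?case by (simp add: ord_less_def)
qed (use assms in simp)

text \<open>Above the order of \<open>(Dx ^^ i) h\<close> the first term of \<open>pd_Dx\<close>
  vanishes, so each \<open>Dx\<close> moves the leading coefficient one index up, unchanged.\<close>

lemma pd_Dx_pow_top:
  assumes "jet_function h" "ord_less h (Suc k)"
  shows "pd (Ju (k + i)) ((Dx ^^ i) h) = pd (Ju k) h"
proof (induction i)
  case (Suc i)
  have "pd (Ju (k + Suc i)) ((Dx ^^ i) h) = 0"
    using ord_lessD[OF ord_less_Dx_pow[OF assms, of i]] by simp
  then show ?case
    using Suc assms by (simp add: pd_Dx pd_pred_def)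
qed simp

text \<open>Each further \<open>Dx\<close> differentiates the leading coefficient once more and
  shifts the old subleading coefficient up, so the copies of \<open>Dx (pd (Ju k) h)\<close> add
  up.\<close>

lemma pd_Dx_pow_subtop:
  assumes h: "jet_function h" "ord_less h (Suc k)"
  shows "pd (Ju (k + i)) ((Dx ^^ Suc i) h) = of_nat (Suc i) * Dx (pd (Ju k) h) + pd_pred k h"
proof (induction i)
  case 0
  then show ?case using assms by (simp add: pd_Dx)
next
  case (Suc i)
  have "pd (Ju (k + Suc i)) (Dx ((Dx ^^ Suc i) h))
      = Dx (pd (Ju (k + Suc i)) ((Dx ^^ Suc i) h)) + pd (Ju (k + i)) ((Dx ^^ Suc i) h)"
    using h by (simp add: pd_Dx pd_pred_def del: funpow.simps)
  also have "\<dots> = Dx (pd (Ju k) h) + (of_nat (Suc i) * Dx (pd (Ju k) h) + pd_pred k h)"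
    by (simp only: Suc pd_Dx_pow_top[OF h])
  finally show ?case by (simp add: algebra_simps)
qed

text \<open>The leading coefficient of \<open>h\<close> is also that of \<open>Dx h\<close>, so it
  vanishes; descending through the orders removes all u_i. What then remains of \<open>Dx h\<close>
  is \<open>pd Jx h\<close>.\<close>

lemma Dx_eq_0D:
  assumes "jet_function h" "Dx h = 0"
  shows "pd (Ju i) h = 0" "pd Jx h = 0"
proof -
  have "ord_less h 0" if "ord_less h N" for N
    using that
  proof (induction N)
    case (Suc N)
    have "pd (Ju N) h = pd (Ju (N + 1)) (Dx h)"
      using pd_Dx_pow_top[OF assms(1) Suc.prems, of 1] by simp
    then have "ord_less h N" using Suc.prems assms(2) by (simp add: ord_less_SucD)
    then show ?case by (rule Suc.IH)
  qed
  then have 0: "ord_less h 0" using ord_less_exists[OF assms(1)] by metis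
  then show "pd (Ju i) h = 0" by (simp add: ord_less_def)
  show "pd Jx h = 0" using Dx_eq[OF 0] assms(2) by simp
qed

subsection \<open>The bracket\<close>

lemma frechet_eq:
  assumes "ord_less h N"
  shows "frechet h r = (\<Sum>i<N. pd (Ju i) h * (Dx ^^ i) r)"
proof
  fix p
  have "frechet h r p = (\<Sum>i<N. pd (Ju i) h p * (Dx ^^ i) r p)"
    unfolding frechet_def
    by (rule nonzero_sum_eq_bounded_sum) (use ord_lessD[OF assms] in auto)
  then show "frechet h r p = (\<Sum>i<N. pd (Ju i) h * (Dx ^^ i) r) p" by simp
qed

lemma bracket_eq:
  assumes "ord_less F N" "ord_less G M"
  shows "bracket F G = (\<Sum>i<N. pd (Ju i) F * (Dx ^^ i) G) - (\<Sum>i<M. pd (Ju i) G * (Dx ^^ i) F)"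
  using frechet_eq[OF assms(1), of G] frechet_eq[OF assms(2), of F]
  by (auto simp: bracket_def fun_eq_iff)

lemma jet_function_bracket:
  assumes "jet_function F" "jet_function G"
  shows "jet_function (bracket F G)"
  using ord_less_exists[OF assms(1)] ord_less_exists[OF assms(2)] bracket_eq assms
  by (metis (no_types, lifting) jet_function_Dx_pow jet_function_diff jet_function_mult
      jet_function_pd jet_function_sum)

lemma bracket_add:
  assumes "jet_function F" "jet_function G" "jet_function H"
  shows "bracket F (G + H) = bracket F G + bracket F H"
proof -
  obtain N M M' where N: "ord_less F N" "ord_less G M" "ord_less H M'"
    using ord_less_exists assms by metis
  define K where "K = max M M'"
  have "ord_less G K" "ord_less H K" using N by (auto simp: K_def elim: ord_less_mono)
  moreover from this have "ord_less (G + H) K" using assms by (simp add: ord_less_def)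
  ultimately show ?thesis
    using N(1) assms by (simp add: bracket_eq Dx_pow_add algebra_simps sum.distrib)
qed

lemma bracket_cscale:
  assumes "jet_function F" "jet_function G"
  shows "bracket F (cscale c G) = cscale c (bracket F G)"
proof -
  obtain N M where N: "ord_less F N" "ord_less G M"
    using ord_less_exists assms by metis
  moreover from this have "ord_less (cscale c G) M"
    using assms by (simp add: ord_less_def cscale_conv_mult)
  ultimately show ?thesis
    using assms by (simp add: bracket_eq Dx_pow_cscale)
      (simp add: cscale_def fun_eq_iff algebra_simps sum_distrib_left)
qed

lemma bracket_sum:
  assumes "jet_function F" "finite A" "\<And>i. i \<in> A \<Longrightarrow> jet_function (G i)"
  shows "bracket F (\<Sum>i\<in>A. cscale (c i) (G i)) = (\<Sum>i\<in>A. cscale (c i) (bracket F (G i)))"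
  using assms(2,3)
proof (induction A rule: finite_induct)
  case empty
  show ?case using bracket_cscale[OF assms(1) jet_function_0, of 0] by (simp add: cscale_def zero_fun_def)
next
  case (insert a A)
  have "bracket F (cscale (c a) (G a) + (\<Sum>i\<in>A. cscale (c i) (G i)))
      = cscale (c a) (bracket F (G a)) + bracket F (\<Sum>i\<in>A. cscale (c i) (G i))"
    using insert.prems assms(1) by (simp add: bracket_add bracket_cscale del: sum_fun_apply)
  also have "bracket F (\<Sum>i\<in>A. cscale (c i) (G i)) = (\<Sum>i\<in>A. cscale (c i) (bracket F (G i)))"
    using insert.prems by (intro insert.IH) auto
  finally show ?case
    unfolding sum.insert[OF insert.hyps(1,2)] .
qed

text \<open>Differentiation by t or x commutes with \<open>Dx\<close> and kills everything built
  from \<open>F\<close> alone, so it maps symmetries to symmetries.\<close>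

lemma pd_bracket:
  assumes "jet_function F" "jet_function G" "v \<in> {Jt, Jx}" "pd v F = 0"
  shows "pd v (bracket F G) = bracket F (pd v G)"
proof -
  obtain N M where N: "ord_less F N" "ord_less G M"
    using ord_less_exists assms by metis
  moreover have "ord_less (pd v G) M"
    using N(2) assms(2) by (simp add: ord_less_def pd_commute_jet[OF assms(2), of _ v])
  moreover have "(Dx ^^ i) (0 :: jet \<Rightarrow> complex) = 0" for i
    by (induction i) (simp_all only: funpow.simps o_apply Dx_0 id_apply)
  moreover have "pd v (pd (Ju i) F) = 0" for i
    by (simp add: pd_commute_jet[OF assms(1), of v] assms(4))
  ultimately show ?thesis
    using assms
    by (simp add: bracket_eq pd_Dx_pow pd_commute_jet[OF assms(2), of v])
qed

subsection \<open>Linear operators on finite-dimensional spaces\<close>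

locale complex_vector_space = vector_space scale for scale :: "complex \<Rightarrow> 'b::ab_group_add \<Rightarrow> 'b"
begin

text \<open>The operators used here, such as \<open>pd v\<close>, are linear on jet functions but
  not on all functions, so linearity is relative to a subspace. \<open>L\<close> may lead out of
  \<open>V\<close>.\<close>

definition linear_map_on :: "'b set \<Rightarrow> ('b \<Rightarrow> 'b) \<Rightarrow> bool" where
  "linear_map_on V L \<longleftrightarrow> subspace V \<and> (\<forall>x\<in>V. \<forall>y\<in>V. L (x + y) = L x + L y) \<and>
     (\<forall>c. \<forall>x\<in>V. L (scale c x) = scale c (L x))"

lemma linear_map_on_subset: "linear_map_on V L \<Longrightarrow> subspace W \<Longrightarrow> W \<subseteq> V \<Longrightarrow> linear_map_on W L"
  unfolding linear_map_on_def by blast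

lemma linear_map_on_add: "linear_map_on V L \<Longrightarrow> x \<in> V \<Longrightarrow> y \<in> V \<Longrightarrow> L (x + y) = L x + L y"
  and linear_map_on_scale: "linear_map_on V L \<Longrightarrow> x \<in> V \<Longrightarrow> L (scale c x) = scale c (L x)"
  and linear_map_on_subspace: "linear_map_on V L \<Longrightarrow> subspace V"
  unfolding linear_map_on_def by blast+

lemma linear_map_on_0: "linear_map_on V L \<Longrightarrow> L 0 = 0"
  using linear_map_on_scale[of V L 0 0] linear_map_on_subspace[of V L] subspace_0 by simp

lemma linear_map_on_diff:
  assumes "linear_map_on V L" "x \<in> V" "y \<in> V"
  shows "L (x - y) = L x - L y"
proof -
  have V: "scale (-1) y \<in> V" using assms linear_map_on_subspace subspace_scale by blast
  have "L (x + scale (-1) y) = L x + scale (-1) (L y)"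
    by (simp only: linear_map_on_add[OF assms(1,2) V] linear_map_on_scale[OF assms(1,3)])
  then show ?thesis by simp
qed

lemma linear_map_on_image_subspace:
  assumes "linear_map_on V L"
  shows "subspace (L ` V)"
proof (rule subspaceI)
  show "0 \<in> L ` V"
    using linear_map_on_0[OF assms] linear_map_on_subspace[OF assms] subspace_0 by (metis image_eqI)
next
  fix x y assume "x \<in> L ` V" "y \<in> L ` V"
  then show "x + y \<in> L ` V"
    using linear_map_on_add[OF assms] subspace_add[OF linear_map_on_subspace[OF assms]] by force
next
  fix c x assume "x \<in> L ` V"
  then obtain v where "v \<in> V" "x = L v" by blast
  then show "scale c x \<in> L ` V"
    using linear_map_on_scale[OF assms] subspace_scale[OF linear_map_on_subspace[OF assms]]
    by (metis image_eqI)
qed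

text \<open>Rank-nullity in the form used throughout: preimages of a basis of the image, together
  with vectors spanning the kernel, span \<open>V\<close>. \<open>B\<close> and \<open>K\<close> may
  contain vectors from outside the image and the kernel.\<close>

lemma finite_span_if_kernel_image:
  assumes L: "linear_map_on V L"
    and "finite B" "L ` V \<subseteq> span B"
    and "finite K" "{v \<in> V. L v = 0} \<subseteq> span K"
  shows "\<exists>C. finite C \<and> V \<subseteq> span C"
proof -
  \<comment> \<open>Vectors of \<open>B\<close> outside the image have no preimages, so a basis is
    chosen inside the image.\<close>
  obtain D where D: "D \<subseteq> L ` V" "independent D" "L ` V \<subseteq> span D"
    using maximal_independent_subset .
  have "finite D"
    using independent_span_bound[OF \<open>finite B\<close> D(2)] D(1) assms(3) by blast
  then obtain C where C: "C \<subseteq> V" "finite C" "D = L ` C"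
    using D(1) finite_subset_image by metis
  have CV: "span C \<subseteq> V" using C(1) linear_map_on_subspace[OF L] by (rule span_minimal)
  have lift: "\<exists>w\<in>span C. L w = y" if "y \<in> span D" for y
    using that
  proof (induction rule: span_induct_alt)
    case base
    show ?case using linear_map_on_0[OF L] span_zero by blast
  next
    case (step c x y)
    then obtain w v where w: "w \<in> span C" "L w = y" "v \<in> C" "L v = x" using C(3) by auto
    have "L (scale c v + w) = scale c (L v) + L w"
      using w C(1) CV L by (simp add: linear_map_on_add linear_map_on_scale linear_map_on_subspace
        subspace_scale subset_iff)
    moreover have "scale c v + w \<in> span C" using w by (simp add: span_add span_scale span_base)
    ultimately show ?case using w by blast
  qed
  have "V \<subseteq> span (C \<union> K)"
  proof
    fix v assume v: "v \<in> V"
    then obtain w where w: "w \<in> span C" "L w = L v" using lift D(3) by blast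
    then have "L (v - w) = 0" "v - w \<in> V"
      using v CV L by (auto simp: linear_map_on_diff intro: subspace_diff linear_map_on_subspace)
    then have "v - w \<in> span (C \<union> K)" using assms(5) span_mono[of K "C \<union> K"] by blast
    moreover have "w \<in> span (C \<union> K)" using w(1) span_mono[of C "C \<union> K"] by blast
    ultimately show "v \<in> span (C \<union> K)" using span_add[of "v - w" "C \<union> K" w] by simp
  qed
  then show ?thesis using C(2) assms(4) by blast
qed

section \<open>Polynomials of a linear operator\<close>

definition poly_op :: "complex poly \<Rightarrow> ('b \<Rightarrow> 'b) \<Rightarrow> 'b \<Rightarrow> 'b" where
  "poly_op p T v = (\<Sum>i\<le>degree p. scale (coeff p i) ((T ^^ i) v))"

lemma poly_op_eq_sum:
  assumes "degree p \<le> N"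
  shows "poly_op p T v = (\<Sum>i\<le>N. scale (coeff p i) ((T ^^ i) v))"
  unfolding poly_op_def
  by (rule sum.mono_neutral_left) (use assms in \<open>auto simp: coeff_eq_0\<close>)

lemma poly_op_0 [simp]: "poly_op 0 T v = 0"
  by (simp add: poly_op_def)

lemma poly_op_1 [simp]: "poly_op 1 T v = v"
  by (simp add: poly_op_def)

text \<open>Horner's recursion, on which the inductions over polynomials below rest.\<close>

lemma poly_op_pCons: "poly_op (pCons a p) T v = scale a v + poly_op p T (T v)"
proof -
  have "poly_op (pCons a p) T v = (\<Sum>i\<le>Suc (degree p). scale (coeff (pCons a p) i) ((T ^^ i) v))"
    by (rule poly_op_eq_sum) (simp add: degree_pCons_le)
  also have "\<dots> = scale a v + poly_op p T (T v)"
    by (simp add: sum.atMost_Suc_shift poly_op_def funpow_swap1 del: sum.atMost_Suc)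
  finally show ?thesis .
qed

lemma poly_op_add: "poly_op (p + q) T v = poly_op p T v + poly_op q T v"
proof -
  define N where "N = max (degree p) (degree q)"
  have "degree (p + q) \<le> N" "degree p \<le> N" "degree q \<le> N"
    by (auto simp: N_def degree_add_le)
  from this[THEN poly_op_eq_sum] show ?thesis
    by (simp add: scale_left_distrib sum.distrib)
qed

lemma poly_op_smult: "poly_op (smult c p) T v = scale c (poly_op p T v)"
  using poly_op_eq_sum[OF degree_smult_le[of c p], of T v]
  by (simp add: poly_op_def scale_sum_right)

context
  fixes V T
  assumes T: "linear_map_on V T" and inv: "T ` V \<subseteq> V"
begin

lemma poly_op_closed: "v \<in> V \<Longrightarrow> poly_op p T v \<in> V"
proof (induction p arbitrary: v)
  case 0
  then show ?case using linear_map_on_subspace[OF T] by (simp add: subspace_0)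
next
  case (pCons a p)
  then show ?case using linear_map_on_subspace[OF T] inv
    by (auto simp: poly_op_pCons intro!: subspace_add subspace_scale)
qed

lemma poly_op_linear_map: "linear_map_on V (poly_op p T)"
proof -
  have "poly_op p T (x + y) = poly_op p T x + poly_op p T y" if "x \<in> V" "y \<in> V" for x y
    using that
  proof (induction p arbitrary: x y)
    case (pCons a p)
    then have "T x \<in> V" "T y \<in> V" using inv by auto
    then show ?case using pCons
      by (simp add: poly_op_pCons scale_right_distrib linear_map_on_add[OF T] add_ac)
  qed simp
  moreover have "poly_op p T (scale c x) = scale c (poly_op p T x)" if "x \<in> V" for c x
    using that
  proof (induction p arbitrary: x)
    case (pCons a p)
    then have "T x \<in> V" using inv by auto
    then show ?case using pCons
      by (simp add: poly_op_pCons scale_right_distrib linear_map_on_scale[OF T] mult.commute)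
  qed simp
  ultimately show ?thesis using linear_map_on_subspace[OF T] by (simp add: linear_map_on_def)
qed

lemma poly_op_commute: "v \<in> V \<Longrightarrow> T (poly_op p T v) = poly_op p T (T v)"
proof (induction p arbitrary: v)
  case 0
  then show ?case using linear_map_on_0[OF T] by simp
next
  case (pCons a p)
  then have "T v \<in> V" using inv by auto
  then show ?case using pCons linear_map_on_subspace[OF T]
    by (simp add: poly_op_pCons linear_map_on_add[OF T] linear_map_on_scale[OF T]
        poly_op_closed subspace_scale)
qed

lemma poly_op_mult: "v \<in> V \<Longrightarrow> poly_op (p * q) T v = poly_op p T (poly_op q T v)"
proof (induction p arbitrary: v)
  case (pCons a p)
  then have "T v \<in> V" using inv by auto
  then show ?case using pCons
    by (simp add: poly_op_pCons poly_op_add poly_op_smult poly_op_commute)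
qed simp

end

text \<open>The d+1 vectors \<open>(T ^^ i) v\<close> with i \<le> d cannot be linearly independent
  in a space of dimension d.\<close>

lemma exists_annihilating_poly:
  assumes "finite B" "V \<subseteq> span B" "T ` V \<subseteq> V" "v \<in> V"
  shows "\<exists>p. p \<noteq> 0 \<and> degree p \<le> dim V \<and> poly_op p T v = 0"
proof -
  define d where "d = dim V"
  define f where "f = (\<lambda>i. (T ^^ i) v)"
  have fV: "f i \<in> V" for i by (induction i) (use assms(3,4) in \<open>auto simp: f_def\<close>)
  \<comment> \<open>Dependence of a set ignores repetitions, so a repeated vector is treated apart;
    it yields the polynomial X^i - X^j.\<close>
  show ?thesis
  proof (cases "inj_on f {..d}")
    case False
    then obtain i j where ij: "i \<le> d" "j \<le> d" "i \<noteq> j" "f i = f j" by (auto simp: inj_on_def)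
    define p :: "complex poly" where "p = monom 1 i - monom 1 j"
    have "coeff p i \<noteq> 0" using ij by (simp add: p_def)
    moreover have deg: "degree p \<le> d"
      unfolding p_def using ij by (intro degree_diff_le) (auto intro: order_trans[OF degree_monom_le])
    moreover have "poly_op p T v = (\<Sum>k\<le>d. scale (of_bool (k = i) - of_bool (k = j)) (f k))"
      unfolding poly_op_eq_sum[OF deg] by (intro sum.cong) (auto simp: p_def f_def)
    moreover have "\<dots> = (\<Sum>k\<le>d. if k = i then f i else 0) - (\<Sum>k\<le>d. if k = j then f j else 0)"
      unfolding sum_subtractf[symmetric] by (intro sum.cong) (auto simp: scale_left_diff_distrib)
    ultimately show ?thesis using ij by (intro exI[of _ p]) (auto simp: d_def)
  next
    case True
    obtain C where C: "C \<subseteq> V" "independent C" "V \<subseteq> span C" "card C = dim V"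
      using basis_exists .
    have "finite C" using independent_span_bound[OF assms(1) C(2)] C(1) assms(2) by blast
    have "dependent (f ` {..d})"
    proof (rule ccontr)
      assume "independent (f ` {..d})"
      from independent_span_bound[OF \<open>finite C\<close> this] have "card (f ` {..d}) \<le> card C"
        using fV C(3) by blast
      then show False using True C(4) by (simp add: card_image d_def)
    qed
    then obtain u where u: "\<exists>w\<in>f ` {..d}. u w \<noteq> 0" "(\<Sum>w\<in>f ` {..d}. scale (u w) w) = 0"
      using dependent_finite[of "f ` {..d}"] by auto
    define p where "p = (\<Sum>i\<le>d. monom (u (f i)) i)"
    have cf: "coeff p i = u (f i)" if "i \<le> d" for i
      using that by (simp add: p_def coeff_sum sum.delta)
    have deg: "degree p \<le> d"
      unfolding p_def by (rule degree_sum_le) (auto intro: order_trans[OF degree_monom_le])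
    have "p \<noteq> 0" using u(1) cf by auto
    moreover have "poly_op p T v = 0"
    proof -
      have "poly_op p T v = (\<Sum>i\<le>d. scale (u (f i)) (f i))"
        unfolding poly_op_eq_sum[OF deg] by (intro sum.cong) (auto simp: cf f_def)
      also have "\<dots> = 0" using u(2) by (simp add: sum.reindex[OF True])
      finally show ?thesis .
    qed
    ultimately show ?thesis using deg by (auto simp: d_def)
  qed
qed

lemma poly_op_linear_factor: "poly_op [:- \<mu>, 1:] T v = T v - scale \<mu> v"
  by (simp add: poly_op_pCons)

text \<open>Primary decomposition, splitting off one root at a time. With \<open>p = l * q\<close>
  and \<open>l\<close> the full power of a linear factor, Bezout's identity writes \<open>v\<close>
  as the sum of a vector killed by \<open>q\<close> and one killed by \<open>l\<close>.\<close>

lemma generalized_eigenspaces_span: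
  assumes T: "linear_map_on V T" "T ` V \<subseteq> V"
    and "v \<in> V" "p \<noteq> 0" "degree p \<le> d" "poly_op p T v = 0"
  shows "v \<in> span {w \<in> V. \<exists>\<mu>. poly_op ([:- \<mu>, 1:] ^ d) T w = 0}"
  using assms(3-)
proof (induction "degree p" arbitrary: p v rule: less_induct)
  case less
  show ?case
  proof (cases "degree p = 0")
    case True
    then obtain c where c: "p = [:c:]" by (rule degree_eq_zeroE)
    then have "v = 0" using less.prems by (simp add: poly_op_pCons)
    then show ?thesis by (simp add: span_zero)
  next
    case False
    then obtain \<mu> where "poly p \<mu> = 0"
      using fundamental_theorem_of_algebra[of p] by (metis constant_degree)
    define m where "m = order \<mu> p"
    define l where "l = [:- \<mu>, 1:] ^ m"
    obtain q where q: "p = l * q" "\<not> [:- \<mu>, 1:] dvd q"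
      using order_decomp[OF \<open>p \<noteq> 0\<close>] by (auto simp: l_def m_def)
    have "m > 0" using \<open>poly p \<mu> = 0\<close> \<open>p \<noteq> 0\<close> by (simp add: m_def order_root)
    have "q \<noteq> 0" "l \<noteq> 0" using q \<open>p \<noteq> 0\<close> by auto
    have "degree l = m" by (simp add: l_def degree_linear_power)
    then have deg: "degree p = m + degree q"
      using \<open>q \<noteq> 0\<close> \<open>l \<noteq> 0\<close> by (simp add: q(1) degree_mult_eq)
    have "coprime [:- \<mu>, 1:] q"
      using q(2) by (intro prime_elem_imp_coprime prime_elem_linear_field_poly) auto
    then have "coprime l q" by (simp add: l_def)
    then have bezout: "fst (bezout_coefficients l q) * l + snd (bezout_coefficients l q) * q = 1"
      by (simp add: bezout_coefficients_fst_snd)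
    define a b where "a = fst (bezout_coefficients l q)" and "b = snd (bezout_coefficients l q)"
    define v1 v2 where "v1 = poly_op (a * l) T v" and "v2 = poly_op (b * q) T v"
    have V: "v1 \<in> V" "v2 \<in> V" using less.prems by (auto simp: v1_def v2_def poly_op_closed[OF T])
    have "v = poly_op 1 T v" by simp
    also have "\<dots> = v1 + v2" by (simp add: v1_def v2_def a_def b_def bezout flip: poly_op_add)
    finally have v: "v = v1 + v2" .
    have 0: "poly_op r T 0 = 0" for r
      by (rule linear_map_on_0[OF poly_op_linear_map[OF T]])
    have "poly_op q T v1 = poly_op (a * p) T v"
      using less.prems by (simp add: v1_def q(1) ac_simps flip: poly_op_mult[OF T])
    also have "\<dots> = 0" using less.prems by (simp add: poly_op_mult[OF T] 0)
    finally have 1: "poly_op q T v1 = 0" .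
    have "v1 \<in> span {w \<in> V. \<exists>\<mu>. poly_op ([:- \<mu>, 1:] ^ d) T w = 0}"
      by (rule less.hyps[OF _ V(1) \<open>q \<noteq> 0\<close> _ 1]) (use deg \<open>m > 0\<close> less.prems in auto)
    moreover have "v2 \<in> span {w \<in> V. \<exists>\<mu>. poly_op ([:- \<mu>, 1:] ^ d) T w = 0}"
    proof (rule span_base)
      \<comment> \<open>The multiplicity \<open>m\<close> is at most \<open>d\<close>, so the
        exponent can be raised to a value common to all roots.\<close>
      have "[:- \<mu>, 1:] ^ d = [:- \<mu>, 1:] ^ (d - m) * l"
        using deg less.prems by (simp add: l_def flip: power_add)
      then have "poly_op ([:- \<mu>, 1:] ^ d) T v2 = poly_op ([:- \<mu>, 1:] ^ (d - m) * b * p) T v"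
        using less.prems by (simp add: v2_def q(1) ac_simps flip: poly_op_mult[OF T])
      also have "\<dots> = 0" using less.prems by (simp add: poly_op_mult[OF T] 0)
      finally show "v2 \<in> {w \<in> V. \<exists>\<mu>. poly_op ([:- \<mu>, 1:] ^ d) T w = 0}" using V by blast
    qed
    ultimately show ?thesis unfolding v by (rule span_add)
  qed
qed

text \<open>Induction on the degree: if \<open>p = [:- \<mu>, 1:] * q\<close>, the kernel of T -
  \<mu> is finite-dimensional by assumption and its image is annihilated by
  \<open>q\<close>.\<close>

lemma finite_span_if_annihilated:
  assumes "p \<noteq> 0" "linear_map_on V T" "T ` V \<subseteq> V" "\<And>v. v \<in> V \<Longrightarrow> poly_op p T v = 0"
    and "\<And>\<mu>. \<exists>K. finite K \<and> {v \<in> V. T v = scale \<mu> v} \<subseteq> span K"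
  shows "\<exists>C. finite C \<and> V \<subseteq> span C"
  using assms
proof (induction "degree p" arbitrary: p V)
  case 0
  then obtain c where c: "p = [:c:]" by (metis degree_eq_zeroE)
  then have "V \<subseteq> span {}" using "0.prems" by (auto simp: poly_op_pCons)
  then show ?case by blast
next
  case (Suc d)
  note T = Suc.prems(2,3)
  obtain \<mu> where "poly p \<mu> = 0"
    using fundamental_theorem_of_algebra[of p] Suc.hyps(2) by (metis constant_degree nat.distinct(1))
  then obtain q where q: "p = [:- \<mu>, 1:] * q" using poly_eq_0_iff_dvd by blast
  have "q \<noteq> 0" using q Suc.prems(1) by auto
  have "degree p = degree [:- \<mu>, 1:] + degree q"
    unfolding q using \<open>q \<noteq> 0\<close> by (intro degree_mult_eq) auto
  then have deg: "d = degree q" using Suc.hyps(2) by simp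
  define L where "L = poly_op [:- \<mu>, 1:] T"
  have L: "linear_map_on V L" unfolding L_def by (rule poly_op_linear_map[OF T])
  have LV: "L ` V \<subseteq> V" using poly_op_closed[OF T] by (auto simp: L_def)
  have W: "linear_map_on (L ` V) T"
    by (rule linear_map_on_subset[OF T(1) linear_map_on_image_subspace[OF L] LV])
  have "\<exists>C. finite C \<and> L ` V \<subseteq> span C"
  proof (rule Suc.hyps(1)[OF deg \<open>q \<noteq> 0\<close> W])
    show "T ` L ` V \<subseteq> L ` V"
      using T(2) by (auto simp: L_def poly_op_commute[OF T] intro!: imageI)
    show "poly_op q T w = 0" if "w \<in> L ` V" for w
      using that Suc.prems(4) by (auto simp: L_def q mult.commute simp flip: poly_op_mult[OF T])
    show "\<exists>K. finite K \<and> {v \<in> L ` V. T v = scale \<nu> v} \<subseteq> span K" for \<nu>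
    proof -
      obtain K where "finite K" "{v \<in> V. T v = scale \<nu> v} \<subseteq> span K" using Suc.prems(5) by blast
      then show ?thesis using LV by blast
    qed
  qed
  moreover have "{v \<in> V. L v = 0} = {v \<in> V. T v = scale \<mu> v}"
    by (simp add: L_def poly_op_linear_factor)
  ultimately show ?case
    using finite_span_if_kernel_image[OF L] Suc.prems(5)[of \<mu>] by metis
qed

end

interpretation jetfun: complex_vector_space cscale
  by unfold_locales

section \<open>Finite-dimensional function spaces and linear differential equations\<close>

text \<open>On a finite-dimensional space of functions, the values at finitely many points serve as
  coordinates, with dual basis \<open>e\<close>. This later turns an evolution equation into
  ordinary differential equations for point values.\<close>

lemma dual_points:
  assumes "finite B"
  shows "\<exists>P e. finite P \<and> (\<forall>p\<in>P. e p \<in> jetfun.span B) \<and> (\<forall>p\<in>P. \<forall>q\<in>P. e p q = of_bool (p = q)) \<and>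
    (\<forall>w\<in>jetfun.span B. \<forall>x. w x = (\<Sum>p\<in>P. w p * e p x))"
  using assms
proof (induction B rule: finite_induct)
  case empty
  then show ?case by (intro exI[of _ "{}"]) auto
next
  case (insert b B)
  obtain P e where fin: "finite P" and span: "\<forall>p\<in>P. e p \<in> jetfun.span B"
      and dual: "\<forall>p\<in>P. \<forall>q\<in>P. e p q = of_bool (p = q)"
      and expand: "\<forall>w\<in>jetfun.span B. \<forall>x. w x = (\<Sum>p\<in>P. w p * e p x)"
    using insert.IH by (elim exE conjE) (rule that; assumption)
  note P = fin span[THEN bspec] dual[THEN bspec, THEN bspec] expand[THEN bspec, THEN spec]
  have sub: "jetfun.span B \<subseteq> jetfun.span (insert b B)" by (rule jetfun.span_mono) auto
  \<comment> \<open>\<open>r\<close> is the error of interpolating \<open>b\<close> at the points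
    \<open>P\<close>. If it is zero, \<open>P\<close> already suffices; otherwise a point where it
    does not vanish is added.\<close>
  define r where "r = b - (\<Sum>p\<in>P. cscale (b p) (e p))"
  have r: "b x = r x + (\<Sum>p\<in>P. b p * e p x)" for x
    by (simp add: r_def cscale_def)
  have decomp: "\<exists>\<beta>. \<forall>x. w x = \<beta> * r x + (\<Sum>p\<in>P. w p * e p x)" if "w \<in> jetfun.span (insert b B)" for w
  proof -
    obtain \<beta> where "w - cscale \<beta> b \<in> jetfun.span B"
      using \<open>w \<in> _\<close> by (auto simp: jetfun.span_insert)
    note expand_diff = P(4)[OF this, unfolded minus_apply cscale_def]
    have "w x = \<beta> * r x + (\<Sum>p\<in>P. w p * e p x)" for x
    proof -
      have "w x = (\<Sum>p\<in>P. (w p - \<beta> * b p) * e p x) + \<beta> * b x"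
        using expand_diff[of x] by (simp only: diff_eq_eq)
      also have "b x = r x + (\<Sum>p\<in>P. b p * e p x)" by (rule r)
      finally show ?thesis
        by (simp add: algebra_simps sum_distrib_left sum_subtractf)
    qed
    then show ?thesis by blast
  qed
  show ?case
  proof (cases "\<forall>x. r x = 0")
    case True
    show ?thesis
    proof (intro exI[of _ P] exI[of _ e] conjI ballI allI)
      show "w x = (\<Sum>p\<in>P. w p * e p x)" if w: "w \<in> jetfun.span (insert b B)" for w x
      proof -
        obtain \<beta> where "\<forall>x. w x = \<beta> * r x + (\<Sum>p\<in>P. w p * e p x)"
          using decomp[OF w] by blast
        from this[THEN spec, of x] True show ?thesis by simp
      qed
    qed (use fin span dual sub in \<open>blast+\<close>)
  next
    case False
    then obtain z where z: "r z \<noteq> 0" by blast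
    have rP: "r q = 0" if "q \<in> P" for q
    proof -
      have "(\<Sum>p\<in>P. b p * e p q) = (\<Sum>p\<in>P. if p = q then b q else 0)"
        using that by (intro sum.cong) (auto simp: P(3))
      then show ?thesis using r[of q] that sum.delta[OF fin, of q "\<lambda>_. b q"] by simp
    qed
    then have "z \<notin> P" using z by blast
    define ez where "ez = cscale (1 / r z) r"
    \<comment> \<open>As in Lagrange interpolation: the normalised error \<open>ez\<close> is 1 at
      \<open>z\<close> and 0 on \<open>P\<close>, and it corrects the old functions to vanish at
      \<open>z\<close>.\<close>
    define e' where "e' = (\<lambda>p. if p = z then ez else e p - cscale (e p z) ez)"
    have "r \<in> jetfun.span (insert b B)"
      unfolding r_def using span sub jetfun.span_base[of b "insert b B"]
      by (intro jetfun.span_diff jetfun.span_sum jetfun.span_scale) blast+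
    then have ez: "ez \<in> jetfun.span (insert b B)" unfolding ez_def by (rule jetfun.span_scale)
    show ?thesis
    proof (intro exI[of _ "insert z P"] exI[of _ e'] conjI ballI allI)
      show "finite (insert z P)" using P(1) by simp
      show "e' p \<in> jetfun.span (insert b B)" if "p \<in> insert z P" for p
        using that span sub ez unfolding e'_def by (auto intro!: jetfun.span_diff jetfun.span_scale)
      show "e' p q = of_bool (p = q)" if "p \<in> insert z P" "q \<in> insert z P" for p q
        using that \<open>z \<notin> P\<close> z by (auto simp: e'_def ez_def cscale_def rP P(3))
      fix w x
      assume "w \<in> jetfun.span (insert b B)"
      then obtain \<beta> where \<beta>: "\<And>x. w x = \<beta> * r x + (\<Sum>p\<in>P. w p * e p x)" using decomp by blast
      have "(\<Sum>p\<in>insert z P. w p * e' p x)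
          = w z * ez x + (\<Sum>p\<in>P. w p * e p x - w p * e p z * ez x)"
        using P(1) \<open>z \<notin> P\<close> by (auto simp: e'_def cscale_def algebra_simps intro!: sum.cong)
      also have "\<dots> = (w z - (\<Sum>p\<in>P. w p * e p z)) * ez x + (\<Sum>p\<in>P. w p * e p x)"
        by (simp add: sum_subtractf sum_distrib_left algebra_simps)
      also have "w z - (\<Sum>p\<in>P. w p * e p z) = \<beta> * r z" using \<beta>[of z] by simp
      also have "\<beta> * r z * ez x + (\<Sum>p\<in>P. w p * e p x) = w x"
        using \<beta>[of x] z by (simp add: ez_def cscale_def)
      finally show "w x = (\<Sum>p\<in>insert z P. w p * e' p x)" ..
    qed
  qed
qed

text \<open>\<open>E t * exp (- C * t)\<close> is nonincreasing and \<open>E t * exp (C * t)\<close>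
  nondecreasing; as both vanish at 0, \<open>E\<close> cannot be positive on either side.\<close>

lemma gronwall_zero:
  fixes E E' :: "real \<Rightarrow> real"
  assumes "\<And>t. (E has_real_derivative E' t) (at t)" "\<And>t. \<bar>E' t\<bar> \<le> C * E t" "\<And>t. E t \<ge> 0" "E 0 = 0"
  shows "E t = 0"
proof (cases "t \<ge> 0")
  case True
  have "E t * exp (- C * t) \<le> E 0 * exp (- C * 0)"
  proof (rule DERIV_nonpos_imp_nonincreasing[OF True, where f = "\<lambda>t. E t * exp (- C * t)"])
    fix x
    have "((\<lambda>t. E t * exp (- C * t)) has_real_derivative (E' x - C * E x) * exp (- C * x)) (at x)"
      by (rule derivative_eq_intros assms(1) refl | simp add: algebra_simps)+
    moreover have "(E' x - C * E x) * exp (- C * x) \<le> 0"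
      using assms(2)[of x] by (simp add: mult_le_0_iff)
    ultimately show "\<exists>y. ((\<lambda>t. E t * exp (- C * t)) has_real_derivative y) (at x) \<and> y \<le> 0" by blast
  qed
  then show ?thesis using assms(3)[of t] assms(4) by (simp add: mult_le_0_iff)
next
  case False
  have "E t * exp (C * t) \<le> E 0 * exp (C * 0)"
  proof (rule DERIV_nonneg_imp_nondecreasing[where a = t and f = "\<lambda>t. E t * exp (C * t)"])
    show "t \<le> 0" using False by simp
    fix x
    have "((\<lambda>t. E t * exp (C * t)) has_real_derivative (E' x + C * E x) * exp (C * x)) (at x)"
      by (rule derivative_eq_intros assms(1) refl | simp add: algebra_simps)+
    moreover have "(E' x + C * E x) * exp (C * x) \<ge> 0"
      using assms(2)[of x] by simp
    ultimately show "\<exists>y. ((\<lambda>t. E t * exp (C * t)) has_real_derivative y) (at x) \<and> 0 \<le> y" by blast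
  qed
  then show ?thesis using assms(3)[of t] assms(4) by (simp add: mult_le_0_iff)
qed

text \<open>Energy estimate: the sum \<open>E\<close> of the squared moduli satisfies the
  differential inequality of \<open>gronwall_zero\<close>.\<close>

lemma linear_ode_unique_zero:
  fixes y :: "'i \<Rightarrow> real \<Rightarrow> complex"
  assumes "finite P"
    and der: "\<And>p t. p \<in> P \<Longrightarrow> (y p has_vector_derivative (\<Sum>q\<in>P. y q t * A p q)) (at t)"
    and init: "\<And>p. p \<in> P \<Longrightarrow> y p 0 = 0" and "p \<in> P"
  shows "y p t = 0"
proof -
  define E where "E = (\<lambda>t. \<Sum>p\<in>P. y p t \<bullet> y p t)"
  define E' where "E' = (\<lambda>t. \<Sum>p\<in>P. 2 * (y p t \<bullet> (\<Sum>q\<in>P. y q t * A p q)))"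
  \<comment> \<open>Every modulus is at most \<open>sqrt (E t)\<close>, so by Cauchy-Schwarz each
    matrix entry contributes at most its norm times \<open>E t\<close>; the 2 comes from
    differentiating a square.\<close>
  define C where "C = (\<Sum>p\<in>P. \<Sum>q\<in>P. 2 * norm (A p q))"
  have E0: "E t \<ge> 0" for t unfolding E_def by (intro sum_nonneg) simp
  have le: "norm (y p t) \<le> sqrt (E t)" if "p \<in> P" for p t
  proof -
    have "y p t \<bullet> y p t \<le> E t"
      unfolding E_def using that \<open>finite P\<close> by (intro member_le_sum) auto
    then show ?thesis by (simp add: norm_eq_sqrt_inner)
  qed
  have "E t = 0" for t
  proof (rule gronwall_zero[where E = E and E' = E' and C = C])
    show "(E has_real_derivative E' t) (at t)" for t
      unfolding E_def E'_def
    proof (rule DERIV_sum)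
      fix p assume "p \<in> P"
      from bounded_bilinear.has_vector_derivative[OF bounded_bilinear_inner der[OF this] der[OF this]]
      show "((\<lambda>t. y p t \<bullet> y p t) has_real_derivative 2 * (y p t \<bullet> (\<Sum>q\<in>P. y q t * A p q))) (at t)"
        by (simp add: has_real_derivative_iff_has_vector_derivative inner_commute)
    qed
    show "\<bar>E' t\<bar> \<le> C * E t" for t
    proof -
      have "\<bar>2 * (y p t \<bullet> (\<Sum>q\<in>P. y q t * A p q))\<bar> \<le> (\<Sum>q\<in>P. 2 * norm (A p q)) * E t" if "p \<in> P" for p
      proof -
        have "\<bar>y p t \<bullet> (\<Sum>q\<in>P. y q t * A p q)\<bar> \<le> norm (y p t) * norm (\<Sum>q\<in>P. y q t * A p q)"
          by (rule Cauchy_Schwarz_ineq2)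
        also have "\<dots> \<le> sqrt (E t) * (\<Sum>q\<in>P. sqrt (E t) * norm (A p q))"
        proof (intro mult_mono le that sum_norm_le)
          show "norm (y q t * A p q) \<le> sqrt (E t) * norm (A p q)" if "q \<in> P" for q
            using le[OF that] by (simp add: norm_mult mult_right_mono)
        qed (use E0 in auto)
        also have "\<dots> = (sqrt (E t) * sqrt (E t)) * (\<Sum>q\<in>P. norm (A p q))"
          by (simp only: sum_distrib_left mult.assoc)
        also have "\<dots> = (\<Sum>q\<in>P. norm (A p q)) * E t"
          using E0 by (simp add: mult.commute)
        finally show ?thesis by (simp add: sum_distrib_left[symmetric] abs_mult mult.assoc)
      qed
      then have "\<bar>E' t\<bar> \<le> (\<Sum>p\<in>P. (\<Sum>q\<in>P. 2 * norm (A p q)) * E t)"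
        unfolding E'_def by (intro order_trans[OF sum_abs] sum_mono)
      then show ?thesis by (simp add: C_def sum_distrib_right)
    qed
  qed (use E0 init in \<open>auto simp: E_def\<close>)
  then show ?thesis using le[OF \<open>p \<in> P\<close>, of t] by simp
qed

subsection \<open>Substituting a value for a coordinate\<close>

text \<open>With \<open>w = Jt\<close> this is the value at a fixed time, kept as a function of all
  jet coordinates so that \<open>Dx\<close> and \<open>bracket\<close> still apply to it.\<close>

definition freeze :: "jvar \<Rightarrow> real \<Rightarrow> (jet \<Rightarrow> complex) \<Rightarrow> jet \<Rightarrow> complex" where
  "freeze w s h p = h (p(w := s))"

lemma freeze_algebra [simp]:
  "freeze w s (f + g) = freeze w s f + freeze w s g"
  "freeze w s (f - g) = freeze w s f - freeze w s g"
  "freeze w s (f * g) = freeze w s f * freeze w s g"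
  "freeze w s (cscale c f) = cscale c (freeze w s f)"
  "freeze w s 0 = 0"
  by (simp_all add: fun_eq_iff freeze_def cscale_def)

lemma freeze_sum [simp]: "freeze w s (\<Sum>i\<in>A. f i) = (\<Sum>i\<in>A. freeze w s (f i))"
  by (simp add: fun_eq_iff freeze_def)

lemma pd_freeze: "pd v (freeze w s h) = (if v = w then 0 else freeze w s (pd v h))"
  by (auto simp: pd_def freeze_def fun_eq_iff fun_upd_twist[of v w])

lemma jet_function_freeze [simp, intro]:
  assumes "jet_function h"
  shows "jet_function (freeze w s h)"
proof -
  have cont: "continuous_on UNIV (freeze w s h)" if "continuous_on UNIV h" for h
  proof -
    have "continuous_on UNIV (\<lambda>p::jet. p(w := s))"
    proof (rule continuous_on_coordinatewise_then_product)
      show "continuous_on UNIV (\<lambda>p::jet. (p(w := s)) i)" for i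
        by (cases "i = w") (auto intro: continuous_on_coordinate)
    qed
    from continuous_on_compose2[OF that this] show ?thesis
      by (simp add: freeze_def[abs_def])
  qed
  have "Ck_on k UNIV (freeze w s h)" if "smooth_on UNIV h" for k h
    using that
  proof (induction k arbitrary: h)
    case 0
    then show ?case by (simp add: cont smooth_on_continuous)
  next
    case (Suc k)
    show ?case
    proof (rule Ck_on_SucI[where h' = "\<lambda>v. if v = w then 0 else freeze w s (pd v h)"])
      show "continuous_on UNIV (freeze w s h)" by (simp add: Suc.prems cont smooth_on_continuous)
      show "((\<lambda>r. freeze w s h (p(v := r))) has_vector_derivative
          (if v = w then 0 else freeze w s (pd v h)) p) (at (p v))" for v p
      proof (cases "v = w")
        case False
        then have "(p(w := s))(v := r) = (p(v := r))(w := s)" for r by (rule fun_upd_twist[symmetric])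
        moreover have "(p(v := p v))(w := s) = p(w := s)" by simp
        ultimately show ?thesis
          using smooth_on_has_pd[OF Suc.prems, of "p(w := s)" v "p v"] False
          by (simp add: freeze_def del: fun_upd_apply)
      qed (simp add: freeze_def)
      show "Ck_on k UNIV (if v = w then 0 else freeze w s (pd v h))" for v
        using Suc Ck_on_const[of k "0 :: complex"] by (simp add: smooth_on_pd zero_fun_def)
    qed
  qed
  then have "smooth_on UNIV (freeze w s h)"
    unfolding smooth_on_def[of UNIV "freeze w s h"] using assms jet_function_smooth by blast
  moreover have "depends_on UNIV A (freeze w s h)" if "depends_on UNIV A h" for A
    using that by (auto simp: depends_on_def freeze_def)
  ultimately show ?thesis using assms unfolding jet_function_def by blast
qed

lemma freeze_eq_if_pd_eq_0: "jet_function h \<Longrightarrow> pd w h = 0 \<Longrightarrow> freeze w s h = h"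
  by (simp add: fun_eq_iff freeze_def constant_along_if_pd_eq_0 del: fun_upd_apply)

lemma ord_less_freeze: "ord_less h N \<Longrightarrow> ord_less (freeze w s h) N"
  by (simp add: ord_less_def pd_freeze)

lemma Dx_freeze:
  assumes "jet_function h"
  shows "Dx (freeze Jt s h) = freeze Jt s (Dx h)"
proof -
  obtain N where N: "ord_less h N" using ord_less_exists[OF assms] .
  show ?thesis
    by (simp add: Dx_eq[OF N] Dx_eq[OF ord_less_freeze[OF N]] pd_freeze freeze_eq_if_pd_eq_0
        zero_fun_def)
qed

lemma Dx_pow_freeze: "jet_function h \<Longrightarrow> (Dx ^^ i) (freeze Jt s h) = freeze Jt s ((Dx ^^ i) h)"
  by (induction i) (simp_all add: Dx_freeze)

text \<open>The bracket involves no derivative by t and \<open>F\<close> does not contain t, so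
  fixing the time commutes with the bracket.\<close>

lemma bracket_freeze:
  assumes "jet_function F" "pd Jt F = 0" "jet_function G"
  shows "bracket F (freeze Jt s G) = freeze Jt s (bracket F G)"
proof -
  obtain N M where N: "ord_less F N" "ord_less G M"
    using ord_less_exists assms by metis
  have "freeze Jt s (pd (Ju i) F) = pd (Ju i) F" for i
    using assms by (intro freeze_eq_if_pd_eq_0) (auto simp: pd_commute_jet[of F Jt])
  moreover have "freeze Jt s ((Dx ^^ i) F) = (Dx ^^ i) F" for i
    using Dx_pow_freeze[OF assms(1), of i s] assms by (simp add: freeze_eq_if_pd_eq_0)
  ultimately show ?thesis
    using assms by (simp add: bracket_eq[OF N] bracket_eq[OF N(1) ord_less_freeze[OF N(2)]]
        Dx_pow_freeze pd_freeze)
qed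

subsection \<open>Affine right-hand sides\<close>

text \<open>For the identity D(X) = 1, so the prolongation fixes every jet and
  \<open>takes_to\<close> reduces to F = F.\<close>

lemma linear_rhs_linearizable:
  assumes "linear_rhs F" "smooth_on UNIV F"
  shows "linearizable F"
proof -
  let ?T = "\<lambda>p::jet. p Jt" and ?X = "\<lambda>p::jet. p Jx" and ?U = "\<lambda>p::jet. p (Ju 0)"
    and ?P = "\<lambda>p::jet. p (Ju 1)"
  have pd: "pd v (\<lambda>p. p w) p = of_bool (v = w)" for v w and p :: jet
    using pd_coordinate[where ?'b = real, of v w] by (simp add: fun_eq_iff)
  have Dx_X: "Dx ?X p = 1" for p by (simp add: Dx_def pd)
  have Dx_u: "Dx (\<lambda>p. p (Ju i)) p = p (Ju (Suc i))" for i and p :: jet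
    by (simp add: Dx_def pd)
  have smooth: "smooth_on UNIV (\<lambda>p::jet. p v)" for v
    using smooth_on_coordinate[where ?'b = real, of v] by simp
  have "contact_transformation UNIV ?T ?X ?U ?P"
    using Dx_u[of 0] by (auto simp: contact_transformation_def smooth depends_on_def Dx_X pd det_3)
  moreover have "takes_to UNIV ?T ?X ?U ?P F F"
  proof -
    have prolong: "prolong ?X ?U i = (\<lambda>p. p (Ju i))" for i
      by (induction i) (simp_all add: Dx_X Dx_u)
    have "prolonged ?T ?X ?U p v = p v" for p v by (cases v) (simp_all add: prolong)
    then have prolonged: "prolonged ?T ?X ?U p = p" for p by (rule ext)
    have "frechet (ucoord 0) F = F"
    proof -
      have "ord_less (ucoord 0) 1" by (auto simp: ord_less_def fun_eq_iff)
      from frechet_eq[OF this] show ?thesis by (simp add: fun_eq_iff)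
    qed
    then have U: "frechet (\<lambda>q. of_real (q (Ju 0))) F = F" by (simp add: ucoord_def)
    have "ord_less (\<lambda>q. of_real (q Jx)) 0" by (auto simp: ord_less_def pd_coordinate fun_eq_iff)
    from frechet_eq[OF this] have X: "frechet (\<lambda>q. of_real (q Jx)) F = 0" by simp
    show ?thesis
      unfolding takes_to_def
      by (rule exI[of _ UNIV]) (simp only: assms(2) prolonged U X pd, simp)
  qed
  ultimately show ?thesis using assms(1) unfolding linearizable_def by blast
qed

text \<open>After subtracting the linear part all partial derivatives vanish, so the remainder
  \<open>H\<close> is constant and serves as the inhomogeneity.\<close>

lemma linear_rhs_if_pd_constant:
  assumes F: "jet_function F" "pd Jt F = 0" "pd Jx F = 0" "ord_less F N"
    and const: "\<And>i p q. pd (Ju i) F p = pd (Ju i) F q"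
  shows "linear_rhs F"
proof -
  define a where "a = (\<lambda>i. pd (Ju i) F (\<lambda>_. 0))"
  have a: "pd (Ju i) F = (\<lambda>_. a i)" for i using const by (auto simp: a_def)
  define H where "H = F - (\<Sum>i\<le>N. cscale (a i) (ucoord i))"
  have "pd v H = 0" for v
  proof -
    have "pd v H = pd v F - (\<Sum>i\<le>N. cscale (a i) (\<lambda>p. of_bool (v = Ju i)))"
      using F(1) by (simp add: H_def del: sum_fun_apply)
    then show ?thesis
    proof (cases v)
      case (Ju j)
      have "(\<Sum>i\<le>N. cscale (a i) (\<lambda>p. of_bool (v = Ju i))) = (\<lambda>_. a j)"
      proof (cases "j \<le> N")
        case True
        then show ?thesis using Ju by (simp add: fun_eq_iff cscale_def of_bool_def if_distrib cong: if_cong)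
      next
        case False
        then have "a j = 0" using ord_lessD[OF F(4), of j] by (simp add: a_def)
        then show ?thesis using Ju False by (auto simp: fun_eq_iff cscale_def intro!: sum.neutral)
      qed
      with \<open>pd v H = _\<close> show ?thesis using a[of j] Ju by simp
    qed (use F in \<open>simp_all add: cscale_def fun_eq_iff\<close>)
  qed
  moreover have "jet_function H"
    unfolding H_def by (intro jet_function_diff jet_function_sum jet_function_cscale F(1) jet_function_ucoord)
  ultimately have H: "H p = H (\<lambda>_. 0)" for p
    by (intro constant_if_pd_eq_0)
  have "F p = (\<Sum>i\<le>N. a i * of_real (p (Ju i))) + H p" for p
    by (simp add: H_def cscale_def ucoord_def)
  then have "F p = (\<Sum>i\<le>N. a i * of_real (p (Ju i))) + H (\<lambda>_. 0)" for p
    by (simp only: H[of p])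
  then show ?thesis unfolding linear_rhs_def
    by (intro exI[of _ N] exI[of _ "\<lambda>i _ _. a i"] exI[of _ "\<lambda>_ _. H (\<lambda>_. 0)"]) blast
qed

subsection \<open>Symmetries of the equation\<close>

text \<open>The strict bound adds a level below S^(0), the symmetries depending on t and x only,
  from which the induction on the order starts.\<close>

definition symmetries_less :: "(jet \<Rightarrow> complex) \<Rightarrow> nat \<Rightarrow> (jet \<Rightarrow> complex) set" where
  "symmetries_less F k = {G. jet_function G \<and> pd Jt G = bracket F G \<and> ord_less G k}"

lemma symmetries_eq: "symmetries F = {G. jet_function G \<and> pd Jt G = bracket F G}"
  by (simp add: symmetries_def fun_eq_iff)

text \<open>\<open>jet_ord\<close> is a \<open>Max\<close>, which is informative only for a finite
  set; the bound \<open>N\<close> supplies finiteness.\<close>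

lemma symmetries_le_eq: "symmetries_le F k = symmetries_less F (Suc k)"
proof -
  have "jet_ord G \<le> k \<longleftrightarrow> ord_less G (Suc k)" if G: "jet_function G" for G
  proof -
    let ?K = "{k. \<exists>p. pd (Ju k) G p \<noteq> 0}"
    obtain N where N: "ord_less G N" using ord_less_exists[OF G] .
    then have "?K \<subseteq> {..<N}" by (auto simp: ord_less_def not_le[symmetric])
    then have "finite ?K" using finite_subset by blast
    then have "jet_ord G \<le> k \<longleftrightarrow> (\<forall>i\<in>?K. i \<le> k)" by (simp add: jet_ord_def)
    also have "\<dots> \<longleftrightarrow> ord_less G (Suc k)"
      unfolding ord_less_def fun_eq_iff by (auto simp: not_less_eq_eq)
    finally show ?thesis .
  qed
  then show ?thesis by (auto simp: symmetries_le_def symmetries_eq symmetries_less_def)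
qed

lemma symmetries_less_jet_function: "G \<in> symmetries_less F k \<Longrightarrow> jet_function G"
  by (simp add: symmetries_less_def)

lemma symmetries_less_mono: "k \<le> l \<Longrightarrow> symmetries_less F k \<subseteq> symmetries_less F l"
  by (auto simp: symmetries_less_def intro: ord_less_mono)

lemma ord_less_0 [simp]: "ord_less 0 N"
  by (simp add: ord_less_def)

lemma ord_less_add: "jet_function f \<Longrightarrow> jet_function g \<Longrightarrow> ord_less f N \<Longrightarrow> ord_less g N \<Longrightarrow> ord_less (f + g) N"
  by (simp add: ord_less_def)

lemma ord_less_cscale: "jet_function h \<Longrightarrow> ord_less h N \<Longrightarrow> ord_less (cscale c h) N"
  by (simp add: ord_less_def cscale_conv_mult)

lemma cscale_0 [simp]: "cscale c 0 = 0" "cscale 0 h = 0"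
  by (simp_all add: cscale_def fun_eq_iff)

lemma subspace_symmetries_less:
  assumes "jet_function F"
  shows "jetfun.subspace (symmetries_less F k)"
proof (rule jetfun.subspaceI)
  have "bracket F 0 = 0"
    using bracket_cscale[OF assms jet_function_0, of 0] by simp
  then show "0 \<in> symmetries_less F k" by (simp add: symmetries_less_def)
qed (use assms in \<open>auto simp: symmetries_less_def bracket_add bracket_cscale
  intro: ord_less_add ord_less_cscale\<close>)

lemma linear_map_on_pd:
  assumes "jetfun.subspace V" "\<And>h. h \<in> V \<Longrightarrow> jet_function h"
  shows "jetfun.linear_map_on V (pd v)"
  using assms by (simp add: jetfun.linear_map_on_def)

lemma ord_less_pd: "jet_function h \<Longrightarrow> ord_less h N \<Longrightarrow> ord_less (pd v h) N"
  by (simp add: ord_less_def pd_commute_jet[of h _ v])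

lemma pd_symmetries_less:
  assumes "jet_function F" "v \<in> {Jt, Jx}" "pd v F = 0" "G \<in> symmetries_less F k"
  shows "pd v G \<in> symmetries_less F k"
  using assms pd_bracket[of F G v]
  by (auto simp: symmetries_less_def ord_less_pd pd_commute_jet[of G Jt])

lemma constant_in_span_1: "(\<And>p q. h p = h q) \<Longrightarrow> h \<in> jetfun.span {\<lambda>_. 1}"
proof -
  assume "\<And>p q. h p = h q"
  then have "h = cscale (h (\<lambda>_. 0)) (\<lambda>_. 1)" by (auto simp: cscale_def fun_eq_iff)
  then show ?thesis by (metis jetfun.span_base jetfun.span_scale singletonI)
qed

lemma Dx_pow_0 [simp]: "(Dx ^^ i) (0 :: jet \<Rightarrow> complex) = 0"
  by (induction i) (simp_all only: funpow.simps o_apply Dx_0 id_apply)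

text \<open>Along constant solutions \<open>u\<^sub>1 = u\<^sub>2 = \<dots> = 0\<close>, total derivatives of functions not involving \<open>x\<close>
  vanish.\<close>

definition flat :: "jet \<Rightarrow> bool" where
  "flat p \<longleftrightarrow> (\<forall>i. p (Ju (Suc i)) = 0)"

lemma Dx_flat:
  assumes "jet_function h" "pd Jx h = 0" "flat p"
  shows "Dx h p = 0"
proof -
  obtain N where "ord_less h N" using ord_less_exists[OF assms(1)] .
  from Dx_eq[OF this] show ?thesis using assms by (simp add: flat_def ucoord_def)
qed

text \<open>At flat jets only the commutator term of \<open>pd_Dx\<close> survives, so each
  \<open>Dx\<close> lowers the index of the derivative by one.\<close>

lemma pd_Dx_pow_flat:
  assumes "jet_function h" "pd Jx h = 0" "flat p"
  shows "pd (Ju j) ((Dx ^^ i) h) p = (if i \<le> j then pd (Ju (j - i)) h p else 0)"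
proof (induction i arbitrary: j)
  case (Suc i)
  have "pd Jx (pd (Ju j) ((Dx ^^ i) h)) = pd (Ju j) ((Dx ^^ i) (pd Jx h))"
    using assms(1) by (simp add: pd_commute_jet[of _ Jx] pd_Dx_pow)
  also have "\<dots> = 0" by (simp add: assms(2))
  finally have "Dx (pd (Ju j) ((Dx ^^ i) h)) p = 0"
    using assms by (intro Dx_flat) auto
  then have "pd (Ju j) ((Dx ^^ Suc i) h) p = pd_pred j ((Dx ^^ i) h) p"
    using assms(1) by (simp add: pd_Dx)
  then show ?case using Suc[of "j - 1"] by (cases j) (auto simp: pd_pred_def)
qed simp

section \<open>The right-hand side and the leading coefficient of a symmetry\<close>

locale kdv_like_equation =
  fixes n :: nat and f :: "jet \<Rightarrow> complex"
  assumes n: "n \<ge> 2" and kdv: "kdv_like n f"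
begin

definition F :: "jet \<Rightarrow> complex" where "F = evolution_rhs n f"

lemma F_eq: "F = ucoord n + f"
  by (simp add: F_def evolution_rhs_def ucoord_def fun_eq_iff)

lemma jet_function_f: "jet_function f"
proof -
  have "{Ju i |i. i < n} = Ju ` {..<n}" by auto
  then have "finite {Ju i |i. i < n}" by simp
  then show ?thesis using kdv unfolding kdv_like_def jet_function_def by blast
qed

lemma jet_function_F [simp, intro]: "jet_function F"
  by (simp add: F_eq jet_function_f)

lemma pd_f_eq_0: "v \<notin> {Ju i |i. i < n} \<Longrightarrow> pd v f = 0"
  using kdv pd_eq_0_if_independent unfolding kdv_like_def by blast

lemma pd_F [simp]: "pd Jt F = 0" "pd Jx F = 0"
  by (simp_all add: F_eq jet_function_f pd_f_eq_0) (simp_all add: fun_eq_iff)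

lemma pd_F_top: "pd (Ju n) F = (\<lambda>_. 1)"
  by (simp add: F_eq jet_function_f pd_f_eq_0)

lemma ord_less_F: "ord_less F (Suc n)"
  by (auto simp: ord_less_def F_eq jet_function_f pd_f_eq_0 fun_eq_iff)

text \<open>The derivatives of \<open>F\<close> by these variables are constant; for u_{n-1} this is
  the KdV-like condition on \<open>f\<close>.\<close>

lemma pd_pd_F:
  assumes "v \<in> {Jt, Jx} \<or> (\<exists>j\<ge>n - 1. v = Ju j)"
  shows "pd v (pd (Ju i) F) = 0"
proof -
  have "pd (Ju i) (pd v F) = 0"
  proof (cases "v = Ju (n - 1)")
    case True
    obtain c where "pd (Ju (n - 1)) f = (\<lambda>_. c)" using kdv by (auto simp: kdv_like_def)
    moreover have "n - 1 \<noteq> n" using n by simp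
    ultimately have "pd v F = (\<lambda>_. c)"
      using True by (simp add: F_eq jet_function_f fun_eq_iff)
    then show ?thesis by simp
  next
    case False
    then have "v \<in> {Jt, Jx} \<or> v = Ju n \<or> (\<exists>j\<ge>Suc n. v = Ju j)"
      using assms n by (auto simp: le_eq_less_or_eq Suc_le_eq)
    then show ?thesis using ord_lessD[OF ord_less_F] by (auto simp: pd_F_top)
  qed
  then show ?thesis by (simp add: pd_commute_jet[of F v])
qed

text \<open>Both halves of the bracket contribute \<open>pd_pred k G\<close> and the product of
  \<open>pd (Ju k) G\<close> with \<open>pd (Ju (n - 1)) F\<close>; only n times
  \<open>Dx (pd (Ju k) G)\<close> remains. As just one derivative of the bracket is assumed to
  vanish, this applies to \<open>frozen_symmetries\<close> as well.\<close>

lemma leading_coefficient: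
  assumes G: "jet_function G" "ord_less G (Suc k)"
    and br: "pd (Ju (n + k - 1)) (bracket F G) = 0"
  shows "Dx (pd (Ju k) G) = 0"
proof -
  obtain m where m: "n = Suc m" "m \<ge> 1" using n by (cases n) auto
  let ?j = "m + k"
  \<comment> \<open>Since n \<ge> 2, u_{m+k} lies above the order of \<open>G\<close>, and by
    \<open>pd_pd_F\<close> it is absent from the coefficients of \<open>F\<close>. So
    differentiation only hits the factors \<open>(Dx ^^ i) G\<close> and
    \<open>(Dx ^^ i) F\<close>.\<close>
  have G0: "pd (Ju ?j) (pd (Ju i) G) = 0" for i
    using m G(2) by (simp add: pd_commute_jet[OF G(1), of "Ju ?j"] ord_lessD)
  have F0: "pd (Ju ?j) (pd (Ju i) F) = 0" for i
    using m by (intro pd_pd_F) auto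
  have "pd (Ju ?j) ((Dx ^^ i) G) = 0" if "i < m" for i
    using ord_lessD[OF ord_less_Dx_pow[OF G, of i]] that by simp
  moreover have "pd (Ju ?j) ((Dx ^^ m) G) = pd (Ju k) G"
    using pd_Dx_pow_top[OF G, of m] by (simp add: add.commute)
  moreover have "pd (Ju ?j) ((Dx ^^ Suc m) G) = of_nat (Suc m) * Dx (pd (Ju k) G) + pd_pred k G"
    using pd_Dx_pow_subtop[OF G, of m] by (simp add: add.commute)
  ultimately have 1: "(\<Sum>i<Suc n. pd (Ju i) F * pd (Ju ?j) ((Dx ^^ i) G))
      = of_nat n * Dx (pd (Ju k) G) + pd_pred k G + pd (Ju m) F * pd (Ju k) G"
    using m(1) pd_F_top by (simp add: fun_eq_iff)
  \<comment> \<open>For \<open>k > 0\<close> this is a subleading coefficient; the leading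
    coefficient of \<open>F\<close> is 1, so its total derivative drops out.\<close>
  have F: "pd (Ju ?j) ((Dx ^^ k) F) = pd (Ju m) F"
  proof (cases k)
    case (Suc k')
    have "Dx (\<lambda>_. 1 :: complex) = 0"
      by (simp add: Dx_eq[of _ 0] ord_less_def)
    moreover have "pd (Ju (n + k')) ((Dx ^^ Suc k') F) = of_nat (Suc k') * Dx (pd (Ju n) F) + pd_pred n F"
      by (rule pd_Dx_pow_subtop[OF jet_function_F ord_less_F])
    moreover have "pd_pred n F = pd (Ju m) F" by (simp add: pd_pred_def m(1))
    moreover have "?j = n + k'" using Suc m(1) by simp
    ultimately show ?thesis unfolding Suc by (simp only: pd_F_top) simp
  qed simp
  have 2: "(\<Sum>i<Suc k. pd (Ju i) G * pd (Ju ?j) ((Dx ^^ i) F))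
      = pd_pred k G + pd (Ju k) G * pd (Ju m) F"
  proof (cases k)
    case (Suc k')
    have "pd (Ju ?j) ((Dx ^^ i) F) = 0" if "i < k'" for i
      using ord_lessD[OF ord_less_Dx_pow[OF jet_function_F ord_less_F, of i]] that Suc m by simp
    moreover have "?j = n + k'" using Suc m(1) by simp
    then have "pd (Ju ?j) ((Dx ^^ k') F) = (\<lambda>_. 1)"
      using pd_Dx_pow_top[OF jet_function_F ord_less_F, of k'] by (simp only: pd_F_top)
    moreover have "pd (Ju k') G * (\<lambda>_. 1) = pd (Ju k') G" by (simp add: fun_eq_iff)
    ultimately show ?thesis using F Suc by (simp add: pd_pred_def)
  qed (use F in \<open>simp add: pd_pred_def\<close>)
  have "0 = pd (Ju ?j) (bracket F G)" using br m by simp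
  also have "\<dots> = (\<Sum>i<Suc n. pd (Ju i) F * pd (Ju ?j) ((Dx ^^ i) G))
      - (\<Sum>i<Suc k. pd (Ju i) G * pd (Ju ?j) ((Dx ^^ i) F))"
    unfolding bracket_eq[OF ord_less_F G(2)] using G(1) by (simp add: F0 G0 del: sum.lessThan_Suc)
  also have "\<dots> = of_nat n * Dx (pd (Ju k) G)"
    unfolding 1 2 by (simp add: algebra_simps)
  finally show ?thesis using n by (simp add: fun_eq_iff)
qed

section \<open>Symmetries at a fixed time\<close>

text \<open>For k \<le> n-1 these conditions hold at each time for x-independent symmetries of order
  below k: their bracket equals the time derivative, whose order is no larger. The conditions are
  linear and free of t.\<close>

definition frozen_symmetries :: "nat \<Rightarrow> (jet \<Rightarrow> complex) set" where
  "frozen_symmetries k = {w. jet_function w \<and> ord_less w k \<and> pd Jt w = 0 \<and> pd Jx w = 0 \<and>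
     ord_less (bracket F w) (n - 1)}"

lemma subspace_frozen_symmetries: "jetfun.subspace (frozen_symmetries k)"
proof (rule jetfun.subspaceI)
  have "bracket F 0 = 0"
    using bracket_cscale[OF jet_function_F jet_function_0, of 0] by simp
  then show "0 \<in> frozen_symmetries k" by (simp add: frozen_symmetries_def)
qed (auto simp: frozen_symmetries_def bracket_add bracket_cscale jet_function_bracket
  intro: ord_less_add ord_less_cscale)

text \<open>\<open>leading_coefficient\<close> applies because u_{n+k-1} does not occur in the
  bracket. Hence the leading coefficient is constant, and each order contributes at most one
  dimension.\<close>

lemma finite_frozen_symmetries: "\<exists>B. finite B \<and> frozen_symmetries k \<subseteq> jetfun.span B"
proof (induction k)
  case 0
  have "h p = h q" if "h \<in> frozen_symmetries 0" for h p q
  proof (rule constant_if_pd_eq_0)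
    show "pd v h = 0" for v
      using that by (cases v) (auto simp: frozen_symmetries_def ord_less_def)
  qed (use that in \<open>simp add: frozen_symmetries_def\<close>)
  then have "frozen_symmetries 0 \<subseteq> jetfun.span {\<lambda>_. 1}"
    using constant_in_span_1 by blast
  then show ?case by (intro exI[of _ "{\<lambda>_. 1}"]) simp
next
  case (Suc k)
  then obtain K where K: "finite K" "frozen_symmetries k \<subseteq> jetfun.span K" by blast
  show ?case
  proof (rule jetfun.finite_span_if_kernel_image[OF _ _ _ K(1)])
    show "jetfun.linear_map_on (frozen_symmetries (Suc k)) (pd (Ju k))"
      by (rule linear_map_on_pd[OF subspace_frozen_symmetries]) (simp add: frozen_symmetries_def)
    show "finite {\<lambda>_::jet. 1 :: complex}" by simp
    show "pd (Ju k) ` frozen_symmetries (Suc k) \<subseteq> jetfun.span {\<lambda>_. 1}"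
    proof (intro image_subsetI constant_in_span_1)
      fix w p q
      assume w: "w \<in> frozen_symmetries (Suc k)"
      then have jet: "jet_function w" by (simp add: frozen_symmetries_def)
      have "Dx (pd (Ju k) w) = 0"
        using w n by (intro leading_coefficient ord_lessD[of "bracket F w" "n - 1"])
          (auto simp: frozen_symmetries_def)
      then have "pd v (pd (Ju k) w) = 0" for v
        using Dx_eq_0D[of "pd (Ju k) w"] jet w
        by (cases v) (auto simp: frozen_symmetries_def pd_commute_jet[of w Jt])
      then show "pd (Ju k) w p = pd (Ju k) w q"
        using jet by (intro constant_if_pd_eq_0) auto
    qed
    have "w \<in> frozen_symmetries k" if "w \<in> frozen_symmetries (Suc k)" "pd (Ju k) w = 0" for w
      using that by (simp add: frozen_symmetries_def ord_less_SucD)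
    then show "{w \<in> frozen_symmetries (Suc k). pd (Ju k) w = 0} \<subseteq> jetfun.span K"
      using K(2) by blast
  qed
qed

lemma freeze_symmetries_less:
  assumes "G \<in> symmetries_less F k" "k \<le> n - 1" "pd Jx G = 0"
  shows "freeze Jt s G \<in> frozen_symmetries k"
proof -
  have G: "jet_function G" "ord_less G k" "pd Jt G = bracket F G"
    using assms(1) by (auto simp: symmetries_less_def)
  have "pd (Ju j) (pd Jt G) = 0" if "n - 1 \<le> j" for j
    using that assms(2) G(1,2) by (simp add: pd_commute_jet[of G _ Jt] ord_lessD)
  then have "ord_less (freeze Jt s (bracket F G)) (n - 1)"
    by (intro ord_less_freeze) (simp add: ord_less_def G(3)[symmetric])
  then show ?thesis
    using G assms(3) by (simp add: frozen_symmetries_def ord_less_freeze pd_freeze bracket_freeze)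
qed

text \<open>In the expansion of \<open>dual_points\<close>, the coordinates of \<open>G\<close> at
  time t are its point values \<open>y p t\<close>. They solve a linear system with constant
  coefficients and vanish at t = 0, hence always.\<close>

lemma symmetry_eq_0_if_initially_0:
  assumes G: "G \<in> symmetries_less F k" "k \<le> n - 1" "pd Jx G = 0" and init: "freeze Jt 0 G = 0"
  shows "G = 0"
proof -
  have jet: "jet_function G" and eq: "pd Jt G = bracket F G"
    using G(1) by (auto simp: symmetries_less_def)
  obtain B0 where B0: "finite B0" "frozen_symmetries k \<subseteq> jetfun.span B0"
    using finite_frozen_symmetries by blast
  \<comment> \<open>\<open>B0\<close> may contain arbitrary functions; a basis inside
    \<open>frozen_symmetries k\<close> ensures that the \<open>e p\<close> are jet functions, on
    which the bracket is linear.\<close>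
  obtain B where B: "B \<subseteq> frozen_symmetries k" "jetfun.independent B"
      "frozen_symmetries k \<subseteq> jetfun.span B"
    using jetfun.maximal_independent_subset .
  have "finite B"
    using jetfun.independent_span_bound[OF B0(1) B(2)] B(1) B0(2) by blast
  then obtain P e where P: "finite P" and span: "\<forall>p\<in>P. e p \<in> jetfun.span B"
      and expand: "\<forall>w\<in>jetfun.span B. \<forall>x. w x = (\<Sum>p\<in>P. w p * e p x)"
    using dual_points[OF \<open>finite B\<close>] by (elim exE conjE) (rule that; assumption)
  have "jetfun.span B \<subseteq> frozen_symmetries k"
    by (rule jetfun.span_minimal[OF B(1) subspace_frozen_symmetries])
  then have e: "jet_function (e p)" if "p \<in> P" for p
    using span that by (auto simp: frozen_symmetries_def)
  define y where "y = (\<lambda>p t. G (p(Jt := t)))"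
  have expand_G: "freeze Jt t G x = (\<Sum>p\<in>P. y p t * e p x)" for t x
  proof -
    have "freeze Jt t G \<in> jetfun.span B"
      using freeze_symmetries_less[OF G] B(3) by blast
    from expand[THEN bspec, OF this, THEN spec, of x] show ?thesis
      by (simp only: freeze_def y_def)
  qed
  have y0: "y p t = 0" if "p \<in> P" for p t
  proof (rule linear_ode_unique_zero[OF P _ _ that])
    show "y p 0 = 0" for p
      using fun_cong[OF init, of p] by (simp add: freeze_def y_def)
    fix p t
    have "freeze Jt t G = (\<Sum>q\<in>P. cscale (y q t) (e q))"
      by (rule ext) (simp add: expand_G cscale_def)
    \<comment> \<open>Linearity of the bracket exhibits the matrix of the system, with entries
      \<open>bracket F (e q) p\<close>.\<close>
    then have "bracket F (freeze Jt t G) = (\<Sum>q\<in>P. cscale (y q t) (bracket F (e q)))"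
      using bracket_sum[OF jet_function_F P e] by simp
    moreover have "pd Jt G (p(Jt := t)) = bracket F (freeze Jt t G) p"
      using jet by (simp add: bracket_freeze eq freeze_def)
    ultimately have "pd Jt G (p(Jt := t)) = (\<Sum>q\<in>P. y q t * bracket F (e q) p)"
      by (simp add: cscale_def)
    with has_pd[OF jet, of p Jt t]
    show "(y p has_vector_derivative (\<Sum>q\<in>P. y q t * bracket F (e q) p)) (at t)"
      by (simp add: y_def del: fun_upd_apply)
  qed
  show ?thesis
  proof
    fix z
    have "G z = freeze Jt (z Jt) G z" by (simp add: freeze_def)
    also have "\<dots> = 0" unfolding expand_G using y0 by (simp add: sum.neutral)
    finally show "G z = 0 z" by simp
  qed
qed

section \<open>Symmetries independent of x\<close>

lemma subspace_x_independent:
  "jetfun.subspace {G \<in> symmetries_less F k. pd Jx G = 0}"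
proof -
  have "jetfun.subspace (symmetries_less F k)" by (rule subspace_symmetries_less) simp
  then show ?thesis
    unfolding jetfun.subspace_def using symmetries_less_jet_function by auto
qed

text \<open>Evaluation at t = 0 is injective on these symmetries and takes values in a
  finite-dimensional space.\<close>

lemma finite_x_independent_low:
  "\<exists>B. finite B \<and> {G \<in> symmetries_less F (n - 1). pd Jx G = 0} \<subseteq> jetfun.span B"
proof -
  let ?V = "{G \<in> symmetries_less F (n - 1). pd Jx G = 0}"
  obtain B where B: "finite B" "frozen_symmetries (n - 1) \<subseteq> jetfun.span B"
    using finite_frozen_symmetries by blast
  show ?thesis
  proof (rule jetfun.finite_span_if_kernel_image[OF _ B(1)])
    show "jetfun.linear_map_on ?V (freeze Jt 0)"
      using subspace_x_independent by (simp add: jetfun.linear_map_on_def)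
    show "freeze Jt 0 ` ?V \<subseteq> jetfun.span B"
      using freeze_symmetries_less B(2) by blast
    show "finite {}" by simp
    show "{G \<in> ?V. freeze Jt 0 G = 0} \<subseteq> jetfun.span {}"
      using symmetry_eq_0_if_initially_0[of _ "n - 1"] by auto
  qed
qed

text \<open>u_{n+k-1} lies above the order of \<open>G\<close>, hence does not occur in
  \<open>pd Jt G = bracket F G\<close>, and \<open>leading_coefficient\<close> applies. Only t is
  left as a variable of the leading coefficient.\<close>

lemma leading_coefficient_symmetry:
  assumes G: "G \<in> symmetries_less F (Suc k)"
  shows "pd (Ju i) (pd (Ju k) G) = 0" and "pd Jx (pd (Ju k) G) = 0"
proof -
  have jet: "jet_function G" and ord: "ord_less G (Suc k)" and eq: "pd Jt G = bracket F G"
    using G by (auto simp: symmetries_less_def)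
  have "pd (Ju (n + k - 1)) (pd Jt G) = 0"
    using n ord by (simp add: pd_commute_jet[OF jet, of _ Jt] ord_lessD)
  then have "Dx (pd (Ju k) G) = 0"
    using leading_coefficient[OF jet ord] eq by simp
  then show "pd (Ju i) (pd (Ju k) G) = 0" "pd Jx (pd (Ju k) G) = 0"
    using Dx_eq_0D[of "pd (Ju k) G"] jet by auto
qed

text \<open>At flat jets the derivatives of both halves of the bracket by u_k are the same
  convolution of the \<open>pd (Ju i) F\<close> with the \<open>pd (Ju i) G\<close>. Second
  derivatives of \<open>F\<close> do not interfere because k \<ge> n-1.\<close>

lemma leading_coefficient_constant:
  assumes G: "G \<in> symmetries_less F (Suc k)" "pd Jx G = 0" and k: "k \<ge> n - 1"
  shows "pd Jt (pd (Ju k) G) = 0"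
proof -
  have jet: "jet_function G" and ord: "ord_less G (Suc k)" and eq: "pd Jt G = bracket F G"
    using G by (auto simp: symmetries_less_def)
  note top = leading_coefficient_symmetry[OF G(1)]
  have flat0: "pd Jt (pd (Ju k) G) p = 0" if p: "flat p" for p
  proof -
    have F0: "pd (Ju k) (pd (Ju i) F) = 0" for i
      using k by (intro pd_pd_F) auto
    have G0: "pd (Ju k) (pd (Ju i) G) = 0" for i
      using top(1)[of i] by (simp add: pd_commute_jet[OF jet, of "Ju k"])
    let ?a = "\<lambda>i. pd (Ju i) F p" and ?b = "\<lambda>i. pd (Ju i) G p"
    have "pd Jt (pd (Ju k) G) p = pd (Ju k) (bracket F G) p"
      by (simp add: pd_commute_jet[OF jet, of Jt] eq)
    also have "\<dots> = (\<Sum>i<Suc n. ?a i * (if i \<le> k then ?b (k - i) else 0))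
        - (\<Sum>i<Suc k. ?b i * (if i \<le> k then ?a (k - i) else 0))"
      unfolding bracket_eq[OF ord_less_F ord] using jet p G(2)
      by (simp add: F0 G0 pd_Dx_pow_flat del: sum.lessThan_Suc)
    \<comment> \<open>For k = n-1 the index n is cut off by the test i \<le> k; for k > n the added
      indices contribute zero, being above the order of \<open>F\<close>.\<close>
    also have "(\<Sum>i<Suc n. ?a i * (if i \<le> k then ?b (k - i) else 0)) = (\<Sum>i\<le>k. ?a i * ?b (k - i))"
    proof (rule sum.mono_neutral_cong)
      show "?a i * ?b (k - i) = 0" if "i \<in> {..k} - {..<Suc n}" for i
        using that ord_lessD[OF ord_less_F, of i] by simp
    qed auto
    also have "(\<Sum>i<Suc k. ?b i * (if i \<le> k then ?a (k - i) else 0)) = (\<Sum>i\<le>k. ?a i * ?b (k - i))"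
      by (rule sum.reindex_bij_witness[of _ "\<lambda>i. k - i" "\<lambda>i. k - i"]) auto
    finally show ?thesis by simp
  qed
  \<comment> \<open>The time derivative of the leading coefficient depends on t alone, so its values
    at flat jets determine it.\<close>
  let ?g = "pd Jt (pd (Ju k) G)"
  have "depends_on UNIV {Jt} ?g"
  proof (rule depends_on_if_pd_eq_0)
    fix v
    assume "v \<notin> {Jt}"
    then have "pd v (pd (Ju k) G) = 0" using top by (cases v) auto
    then show "pd v ?g = 0" using jet by (simp add: pd_commute_jet[of "pd (Ju k) G" v])
  qed (use jet in auto)
  then have "?g z = ?g ((\<lambda>_. 0)(Jt := z Jt))" for z
    by (rule depends_onD) simp
  moreover have "flat ((\<lambda>_. 0)(Jt := s))" for s by (simp add: flat_def)
  ultimately have "?g z = 0" for z using flat0[of "(\<lambda>_. 0)(Jt := z Jt)"] by simp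
  then show ?thesis by (simp add: fun_eq_iff)
qed

text \<open>Beyond the low orders, each order adds at most one dimension, since the leading
  coefficient is constant in t as well.\<close>

lemma finite_x_independent:
  "\<exists>B. finite B \<and> {G \<in> symmetries_less F k. pd Jx G = 0} \<subseteq> jetfun.span B"
proof (cases "k \<le> n - 1")
  case True
  then show ?thesis using finite_x_independent_low symmetries_less_mono[OF True] by blast
next
  case False
  then have "n - 1 \<le> k" by simp
  then show ?thesis
  proof (induction k rule: dec_induct)
    case base
    show ?case by (rule finite_x_independent_low)
  next
    case (step k)
    let ?V = "{G \<in> symmetries_less F (Suc k). pd Jx G = 0}"
    obtain K where K: "finite K" "{G \<in> symmetries_less F k. pd Jx G = 0} \<subseteq> jetfun.span K"
      using step.IH by blast
    show ?case
    proof (rule jetfun.finite_span_if_kernel_image[OF _ _ _ K(1)])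
      show "jetfun.linear_map_on ?V (pd (Ju k))"
        by (rule linear_map_on_pd[OF subspace_x_independent]) (simp add: symmetries_less_def)
      show "finite {\<lambda>_::jet. 1 :: complex}" by simp
      show "pd (Ju k) ` ?V \<subseteq> jetfun.span {\<lambda>_. 1}"
      proof (intro image_subsetI constant_in_span_1)
        fix G p q
        assume G: "G \<in> ?V"
        then have "pd v (pd (Ju k) G) = 0" for v
          using leading_coefficient_symmetry[of G k] leading_coefficient_constant[of G k] step.hyps
          by (cases v) auto
        then show "pd (Ju k) G p = pd (Ju k) G q"
          using G by (intro constant_if_pd_eq_0) (auto simp: symmetries_less_def)
      qed
      have "G \<in> symmetries_less F k" if "G \<in> symmetries_less F (Suc k)" "pd (Ju k) G = 0" for G
        using that by (simp add: symmetries_less_def ord_less_SucD)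
      then show "{G \<in> ?V. pd (Ju k) G = 0} \<subseteq> jetfun.span K"
        using K(2) by blast
    qed
  qed
qed

section \<open>Symmetries depending on t and x only\<close>

lemma Dx_pow_ord_less_0:
  assumes "jet_function G" "ord_less G 0"
  shows "(Dx ^^ i) G = (pd Jx ^^ i) G"
proof -
  have "jet_function ((pd Jx ^^ i) G) \<and> ord_less ((pd Jx ^^ i) G) 0 \<and> (Dx ^^ i) G = (pd Jx ^^ i) G"
    by (induction i) (use assms in \<open>auto simp: ord_less_pd Dx_eq[of _ 0]\<close>)
  then show ?thesis by simp
qed

text \<open>\<open>G\<close> does not contain any u_i, so the coefficients of \<open>F\<close> may
  be taken at a jet \<open>p\<close> unrelated to \<open>z\<close>. \<open>finite_order_0\<close>
  exploits this freedom.\<close>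

lemma order_0_symmetry_equation:
  assumes "G \<in> symmetries_less F 0"
  shows "pd Jt G z = (\<Sum>i\<le>n. pd (Ju i) F p * (pd Jx ^^ i) G z)"
proof -
  have jet: "jet_function G" and ord: "ord_less G 0" and eq: "pd Jt G = bracket F G"
    using assms by (auto simp: symmetries_less_def)
  have br: "pd Jt G q = (\<Sum>i\<le>n. pd (Ju i) F q * (pd Jx ^^ i) G q)" for q
    unfolding eq bracket_eq[OF ord_less_F ord]
    by (simp add: Dx_pow_ord_less_0[OF jet ord] lessThan_Suc_atMost del: sum.lessThan_Suc)
  have tx: "depends_on UNIV {Jt, Jx} h" if "jet_function h" "ord_less h 0" for h
  proof (rule depends_on_if_pd_eq_0[OF that(1)])
    show "pd v h = 0" if "v \<notin> {Jt, Jx}" for v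
      using that \<open>ord_less h 0\<close> by (cases v) (auto simp: ord_less_def)
  qed
  \<comment> \<open>\<open>q\<close> takes t and x from \<open>z\<close>, to which \<open>F\<close>
    is insensitive, and all u_i from \<open>p\<close>, to which \<open>G\<close> is
    insensitive.\<close>
  define q where "q = p(Jt := z Jt, Jx := z Jx)"
  have "jet_function ((pd Jx ^^ i) G) \<and> ord_less ((pd Jx ^^ i) G) 0" for i
    by (induction i) (use jet ord in \<open>auto simp: ord_less_pd\<close>)
  then have "(pd Jx ^^ i) G q = (pd Jx ^^ i) G z" for i
    by (intro depends_onD[OF tx]) (auto simp: q_def)
  moreover have "pd Jt G q = pd Jt G z"
    using jet ord by (intro depends_onD[OF tx] jet_function_pd ord_less_pd) (auto simp: q_def)
  moreover have "pd (Ju i) F q = pd (Ju i) F p" for i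
    using constant_along_if_pd_eq_0[of "pd (Ju i) F" Jt] constant_along_if_pd_eq_0[of "pd (Ju i) F" Jx]
    by (simp add: q_def pd_pd_F del: fun_upd_apply)
  ultimately show ?thesis using br[of q] by simp
qed

lemma exp_ode_zero:
  fixes y :: "real \<Rightarrow> complex"
  assumes "\<And>t. (y has_vector_derivative c * y t) (at t)" "y 0 = 0"
  shows "y t = 0"
  using linear_ode_unique_zero[of "{()}" "\<lambda>_. y" "\<lambda>_ _. c" "()" t] assms by (simp add: mult.commute)

text \<open>On an eigenspace of \<open>pd Jx\<close> the symmetry equation becomes
  \<open>pd Jt G z = \<nu> * G z\<close>, so \<open>G\<close> is determined by its value at the
  origin.\<close>

lemma finite_order_0_eigenspace:
  "\<exists>K. finite K \<and> {G \<in> symmetries_less F 0. pd Jx G = cscale \<mu> G} \<subseteq> jetfun.span K"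
proof -
  let ?V = "{G \<in> symmetries_less F 0. pd Jx G = cscale \<mu> G}"
  \<comment> \<open>Evaluation at the origin, turned into a constant function so that it maps into
    the same vector space.\<close>
  let ?L = "\<lambda>G. cscale (G (\<lambda>_. 0)) (\<lambda>_. 1)"
  have sub: "jetfun.subspace (symmetries_less F 0)" by (rule subspace_symmetries_less) simp
  show ?thesis
  proof (rule jetfun.finite_span_if_kernel_image[where L = ?L])
    have "jetfun.subspace ?V"
      using sub unfolding jetfun.subspace_def
      by (auto simp: symmetries_less_jet_function jetfun.scale_right_distrib mult.commute)
    then show "jetfun.linear_map_on ?V ?L"
      by (simp add: jetfun.linear_map_on_def cscale_def fun_eq_iff algebra_simps)
    show "finite {\<lambda>_::jet. 1 :: complex}" "finite {}" by simp_all
    show "?L ` ?V \<subseteq> jetfun.span {\<lambda>_. 1}"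
      by (intro image_subsetI jetfun.span_scale jetfun.span_base) simp
    have "G = 0" if "G \<in> ?V" "?L G = 0" for G
    proof
      fix z :: jet
      have jet: "jet_function G" and ord: "ord_less G 0" and x: "pd Jx G = cscale \<mu> G"
        using that by (auto simp: symmetries_less_def)
      define \<nu> where "\<nu> = (\<Sum>i\<le>n. pd (Ju i) F (\<lambda>_. 0) * \<mu> ^ i)"
      have pow: "(pd Jx ^^ i) G = cscale (\<mu> ^ i) G" for i
        by (induction i) (simp_all add: jet x mult.commute)
      have t: "pd Jt G z = \<nu> * G z" for z
        using order_0_symmetry_equation[of G z "\<lambda>_. 0"] that
        by (simp add: pow cscale_def \<nu>_def sum_distrib_right mult.assoc)
      have G0: "G (\<lambda>_. 0) = 0" using that(2) by (simp add: cscale_def fun_eq_iff)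
      \<comment> \<open>The zero at the origin propagates along t, and then along x at each fixed
        time.\<close>
      have 1: "G ((\<lambda>_. 0)(Jt := s)) = 0" for s
      proof (rule exp_ode_zero[where y = "\<lambda>s. G ((\<lambda>_. 0)(Jt := s))" and c = \<nu>])
        show "((\<lambda>s. G ((\<lambda>_. 0)(Jt := s))) has_vector_derivative \<nu> * G ((\<lambda>_. 0)(Jt := s))) (at s)" for s
          using has_pd[OF jet, of "\<lambda>_. 0" Jt s] by (simp add: t del: fun_upd_apply)
        have "(\<lambda>_. 0)(Jt := 0) = (\<lambda>_::jvar. 0::real)" by auto
        then show "G ((\<lambda>_. 0)(Jt := 0)) = 0" using G0 by simp
      qed
      have 2: "G ((\<lambda>_. 0)(Jt := r, Jx := s)) = 0" for r s
      proof (rule exp_ode_zero[where y = "\<lambda>s. G ((\<lambda>_. 0)(Jt := r, Jx := s))" and c = \<mu>])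
        show "((\<lambda>s. G ((\<lambda>_. 0)(Jt := r, Jx := s))) has_vector_derivative
            \<mu> * G ((\<lambda>_. 0)(Jt := r, Jx := s))) (at s)" for s
          using has_pd[OF jet, of "(\<lambda>_. 0)(Jt := r)" Jx s] by (simp add: x cscale_def del: fun_upd_apply)
        have "(\<lambda>_. 0)(Jt := r, Jx := 0) = (\<lambda>_::jvar. 0::real)(Jt := r)" by auto
        then show "G ((\<lambda>_. 0)(Jt := r, Jx := 0)) = 0" using 1 by simp
      qed
      have "depends_on UNIV {Jt, Jx} G"
      proof (rule depends_on_if_pd_eq_0[OF jet])
        show "pd v G = 0" if "v \<notin> {Jt, Jx}" for v
          using that ord by (cases v) (auto simp: ord_less_def)
      qed
      then have "G z = G ((\<lambda>_. 0)(Jt := z Jt, Jx := z Jx))" by (rule depends_onD) auto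
      then show "G z = 0 z" using 2 by simp
    qed
    then show "{G \<in> ?V. ?L G = 0} \<subseteq> jetfun.span {}" by auto
  qed
qed

text \<open>Subtracting \<open>order_0_symmetry_equation\<close> for two jets eliminates the time
  derivative; the differences \<open>d i\<close>, not all zero, are the coefficients of the
  annihilating polynomial.\<close>

lemma finite_order_0:
  assumes "\<not> linearizable F"
  shows "\<exists>B. finite B \<and> symmetries_less F 0 \<subseteq> jetfun.span B"
proof -
  have "\<not> linear_rhs F"
    using assms linear_rhs_linearizable jet_function_smooth[OF jet_function_F] by blast
  then obtain i p q where i: "pd (Ju i) F p \<noteq> pd (Ju i) F q"
    using linear_rhs_if_pd_constant[OF jet_function_F _ _ ord_less_F] by auto
  define d where "d = (\<lambda>i. pd (Ju i) F p - pd (Ju i) F q)"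
  define P where "P = (\<Sum>i\<le>n. monom (d i) i)"
  have cf: "coeff P i = d i" if "i \<le> n" for i
    using that by (simp add: P_def coeff_sum sum.delta)
  have deg: "degree P \<le> n"
    unfolding P_def by (rule degree_sum_le) (auto intro: order_trans[OF degree_monom_le])
  have "i \<le> n"
    using i ord_lessD[OF ord_less_F, of i] by (cases "i \<le> n") auto
  then have "P \<noteq> 0" using cf[of i] i by (auto simp: d_def)
  show ?thesis
  proof (rule jetfun.finite_span_if_annihilated[OF \<open>P \<noteq> 0\<close>, where T = "pd Jx"])
    show "jetfun.linear_map_on (symmetries_less F 0) (pd Jx)"
      by (intro linear_map_on_pd subspace_symmetries_less) (auto simp: symmetries_less_def)
    show "pd Jx ` symmetries_less F 0 \<subseteq> symmetries_less F 0"
      by (intro image_subsetI pd_symmetries_less) auto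
    show "jetfun.poly_op P (pd Jx) G = 0" if "G \<in> symmetries_less F 0" for G
    proof
      fix z
      have "jetfun.poly_op P (pd Jx) G z = (\<Sum>i\<le>n. d i * (pd Jx ^^ i) G z)"
        unfolding jetfun.poly_op_eq_sum[OF deg] by (auto simp: cf cscale_def intro!: sum.cong)
      also have "\<dots> = pd Jt G z - pd Jt G z"
        using order_0_symmetry_equation[OF that, of z p] order_0_symmetry_equation[OF that, of z q]
        by (simp add: d_def left_diff_distrib sum_subtractf)
      finally show "jetfun.poly_op P (pd Jx) G z = 0 z" by simp
    qed
    show "\<exists>K. finite K \<and> {G \<in> symmetries_less F 0. pd Jx G = cscale \<mu> G} \<subseteq> jetfun.span K" for \<mu>
      by (rule finite_order_0_eigenspace)
  qed
qed

section \<open>All symmetries of bounded order\<close>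

text \<open>The leading coefficient does not contain x, so \<open>pd Jx\<close> maps into the space
  of the next lower order, while its kernel is covered by
  \<open>finite_x_independent\<close>.\<close>

lemma finite_symmetries_less:
  assumes "\<not> linearizable F"
  shows "\<exists>B. finite B \<and> symmetries_less F k \<subseteq> jetfun.span B"
proof (induction k)
  case 0
  show ?case by (rule finite_order_0[OF assms])
next
  case (Suc k)
  then obtain B where B: "finite B" "symmetries_less F k \<subseteq> jetfun.span B" by blast
  obtain K where K: "finite K" "{G \<in> symmetries_less F (Suc k). pd Jx G = 0} \<subseteq> jetfun.span K"
    using finite_x_independent by blast
  show ?case
  proof (rule jetfun.finite_span_if_kernel_image[OF _ B(1) _ K])
    show "jetfun.linear_map_on (symmetries_less F (Suc k)) (pd Jx)"
      by (intro linear_map_on_pd subspace_symmetries_less) (auto simp: symmetries_less_def)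
    have "pd Jx G \<in> symmetries_less F k" if G: "G \<in> symmetries_less F (Suc k)" for G
    proof -
      have "pd (Ju k) (pd Jx G) = 0"
        using leading_coefficient_symmetry(2)[OF G] G
        by (simp add: pd_commute_jet[of G "Ju k"] symmetries_less_def)
      moreover have "pd Jx G \<in> symmetries_less F (Suc k)"
        using G by (intro pd_symmetries_less) auto
      ultimately show ?thesis by (simp add: symmetries_less_def ord_less_SucD)
    qed
    then show "pd Jx ` symmetries_less F (Suc k) \<subseteq> jetfun.span B" using B(2) by blast
  qed
qed

end

subsection \<open>Dependence on time\<close>

text \<open>Induction on the exponent with variation of constants:
  \<open>K = pd Jt H - cscale \<mu> H\<close> satisfies the hypothesis with exponent one less, and
  integrating it in t recovers \<open>H\<close>.\<close>

lemma generalized_eigenvector_quasipolynomial: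
  assumes "jet_function H" "ord_less H (Suc k)"
    and "jetfun.poly_op ([:- \<mu>, 1:] ^ d) (pd Jt) H = 0"
  shows "\<exists>h. (\<forall>j. jet_function (h j) \<and> depends_on UNIV ({Jx} \<union> {Ju i |i. i \<le> k}) (h j)) \<and>
    (\<forall>p. H p = exp (\<mu> * of_real (p Jt)) * (\<Sum>j<d. of_real (p Jt) ^ j * h j p))"
  using assms
proof (induction d arbitrary: H)
  case 0
  then have "H = 0" by (simp only: power_0 jetfun.poly_op_1)
  then show ?case
    by (intro exI[of _ "\<lambda>_. 0"]) (simp add: depends_on_def)
next
  case (Suc d)
  have "jetfun.subspace (Collect jet_function)"
    by (rule jetfun.subspaceI) auto
  then have lin: "jetfun.linear_map_on (Collect jet_function) (pd Jt)"
    by (rule linear_map_on_pd) simp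
  define K where "K = pd Jt H - cscale \<mu> H"
  have jetK: "jet_function K" using Suc.prems by (simp add: K_def)
  have "ord_less K (Suc k)"
    using Suc.prems by (simp add: K_def ord_less_def pd_commute_jet[of H _ Jt])
  moreover have "jetfun.poly_op ([:- \<mu>, 1:] ^ d) (pd Jt) K = 0"
  proof -
    have "jetfun.poly_op ([:- \<mu>, 1:] ^ d * [:- \<mu>, 1:]) (pd Jt) H = 0"
      using Suc.prems(3) by (simp only: power_Suc2)
    then show ?thesis
      using jetfun.poly_op_mult[OF lin, of H "[:- \<mu>, 1:] ^ d" "[:- \<mu>, 1:]"] Suc.prems(1)
      by (simp add: jetfun.poly_op_linear_factor K_def image_subset_iff del: mult_pCons_right)
  qed
  ultimately obtain h where jet_h: "\<forall>j. jet_function (h j)"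
      and dep_h: "\<forall>j. depends_on UNIV ({Jx} \<union> {Ju i |i. i \<le> k}) (h j)"
      and K: "\<forall>p. K p = exp (\<mu> * of_real (p Jt)) * (\<Sum>j<d. of_real (p Jt) ^ j * h j p)"
    using Suc.IH[OF jetK] by blast
  \<comment> \<open>Integration from 0 turns t^i into t^{i+1}/(i+1); the constant of integration is
    \<open>H\<close> at t = 0.\<close>
  define h' where "h' = (\<lambda>j. case j of 0 \<Rightarrow> freeze Jt 0 H | Suc i \<Rightarrow> cscale (1 / of_nat (Suc i)) (h i))"
  have "depends_on UNIV ({Jx} \<union> {Ju i |i. i \<le> k}) (freeze Jt 0 H)"
  proof (rule depends_on_if_pd_eq_0)
    show "pd v (freeze Jt 0 H) = 0" if "v \<notin> {Jx} \<union> {Ju i |i. i \<le> k}" for v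
      using that Suc.prems(2) by (cases v) (auto simp: pd_freeze ord_less_def)
  qed (use Suc.prems in auto)
  moreover have "depends_on UNIV ({Jx} \<union> {Ju i |i. i \<le> k}) (cscale c (h j))" for c j
    by (rule depends_on_cscale[OF dep_h[THEN spec]])
  ultimately have h': "jet_function (h' j) \<and> depends_on UNIV ({Jx} \<union> {Ju i |i. i \<le> k}) (h' j)" for j
    using Suc.prems(1) jet_h by (cases j) (simp_all add: h'_def)
  have "H p = exp (\<mu> * of_real (p Jt)) * (\<Sum>j<Suc d. of_real (p Jt) ^ j * h' j p)" for p
  proof -
    have h_shift: "h j (p(Jt := s)) = h j p" for j s
      by (rule depends_onD[OF dep_h[THEN spec]]) auto
    \<comment> \<open>The defect of the claimed identity after division by the exponential: its
      derivative is zero and it vanishes at 0.\<close>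
    define \<phi> where "\<phi> = (\<lambda>s. exp (- \<mu> * of_real s) * H (p(Jt := s))
      - (\<Sum>j<Suc d. of_real s ^ j * h' j p))"
    have "(\<phi> has_vector_derivative 0) (at s)" for s
    proof -
      have e: "((\<lambda>s. exp (- \<mu> * of_real s)) has_vector_derivative - \<mu> * exp (- \<mu> * of_real s)) (at s)"
        by (rule has_vector_derivative_real_field) (auto intro!: derivative_eq_intros)
      have "((\<lambda>z. \<Sum>j<Suc d. z ^ j * h' j p) has_field_derivative
          (\<Sum>j<Suc d. of_nat j * of_real s ^ (j - 1) * h' j p)) (at (of_real s))"
        by (auto intro!: derivative_eq_intros sum.cong simp del: sum.lessThan_Suc)
      then have "((\<lambda>s. \<Sum>j<Suc d. of_real s ^ j * h' j p) has_vector_derivative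
          (\<Sum>j<Suc d. of_nat j * of_real s ^ (j - 1) * h' j p)) (at s)"
        by (rule has_vector_derivative_real_field)
      moreover have "(\<Sum>j<Suc d. of_nat j * of_real s ^ (j - 1) * h' j p)
          = (\<Sum>j<d. of_real s ^ j * h j p)"
      proof -
        have "of_nat (Suc j) * (1 / of_nat (Suc j)) = (1 :: complex)" for j
          by (simp add: of_nat_neq_0 del: of_nat_Suc)
        then have "of_nat (Suc j) * of_real s ^ j * (1 / of_nat (Suc j) * h j p)
            = of_real s ^ j * h j p" for j
          by (metis (no_types, opaque_lifting) mult.assoc mult.commute mult_1)
        then show ?thesis
          by (simp add: sum.lessThan_Suc_shift h'_def cscale_def del: sum.lessThan_Suc of_nat_Suc)
      qed
      ultimately have S: "((\<lambda>s. \<Sum>j<Suc d. of_real s ^ j * h' j p) has_vector_derivative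
          (\<Sum>j<d. of_real s ^ j * h j p)) (at s)"
        by (simp only:)
      have "(\<phi> has_vector_derivative
          (exp (- \<mu> * of_real s) * pd Jt H (p(Jt := s)) + - \<mu> * exp (- \<mu> * of_real s) * H (p(Jt := s)))
          - (\<Sum>j<d. of_real s ^ j * h j p)) (at s)"
        unfolding \<phi>_def
        by (intro has_vector_derivative_diff has_vector_derivative_mult e S has_pd Suc.prems(1))
      moreover have "exp (- \<mu> * of_real s) * pd Jt H (p(Jt := s)) + - \<mu> * exp (- \<mu> * of_real s) * H (p(Jt := s))
          = exp (- \<mu> * of_real s) * K (p(Jt := s))"
        by (simp add: K_def cscale_def algebra_simps)
      moreover have "K (p(Jt := s)) = exp (\<mu> * of_real s) * (\<Sum>j<d. of_real s ^ j * h j p)"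
        using K[THEN spec, of "p(Jt := s)"] by (simp only: h_shift fun_upd_same)
      ultimately show ?thesis
        by (simp add: mult.assoc[symmetric] flip: exp_add)
    qed
    then obtain c where "\<forall>s\<in>UNIV. \<phi> s = c"
      using has_vector_derivative_zero_constant[of UNIV \<phi>] by auto
    moreover have "\<phi> 0 = 0"
      by (simp add: \<phi>_def h'_def freeze_def sum.lessThan_Suc_shift del: sum.lessThan_Suc)
    ultimately have "\<phi> (p Jt) = 0" by auto
    then have "exp (- \<mu> * of_real (p Jt)) * H p = (\<Sum>j<Suc d. of_real (p Jt) ^ j * h' j p)"
      by (simp add: \<phi>_def del: sum.lessThan_Suc)
    then have "exp (\<mu> * of_real (p Jt)) * (exp (- \<mu> * of_real (p Jt)) * H p)
        = exp (\<mu> * of_real (p Jt)) * (\<Sum>j<Suc d. of_real (p Jt) ^ j * h' j p)"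
      by simp
    then show ?thesis by (simp add: mult.assoc[symmetric] del: sum.lessThan_Suc flip: exp_add)
  qed
  with h' show ?case by (intro exI[of _ h']) blast
qed

text \<open>Writing m < dim for m \<le> dim - 1 avoids truncated subtraction; if the dimension is 0,
  then \<open>Q\<close> is 0 and lies in the span of the empty set.\<close>

theorem theorem6:
  fixes n :: nat and f :: "jet \<Rightarrow> complex"
  defines "F \<equiv> evolution_rhs n f"
  assumes "n \<ge> 2"
    and "kdv_like n f"
    and "\<not> linearizable F"
  shows "(\<forall>k. finite_dimensional (symmetries_le F k)) \<and>
    (\<forall>k. \<forall>Q\<in>symmetries F. jet_ord Q = k \<longrightarrow>
      Q \<in> jetfun.span {H \<in> symmetries F.
             \<exists>m. m < jetfun.dim (symmetries_le F k) \<and> quasipolynomial k m H})"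
proof -
  interpret eqn: kdv_like_equation n f using assms by unfold_locales auto
  have F: "eqn.F = F" by (simp add: eqn.F_def F_def)
  note jet_F = eqn.jet_function_F[unfolded F] and pd_F = eqn.pd_F[unfolded F]
  have finite_span: "\<exists>B. finite B \<and> symmetries_le F k \<subseteq> jetfun.span B" for k
    unfolding symmetries_le_eq using eqn.finite_symmetries_less assms(4) by (simp add: F)
  have "finite_dimensional (symmetries_le F k)" for k
  proof -
    obtain B0 where B0: "finite B0" "symmetries_le F k \<subseteq> jetfun.span B0" using finite_span by blast
    \<comment> \<open>\<open>finite_dimensional\<close> asks for a spanning set inside the space,
      hence the passage to a basis.\<close>
    obtain B where B: "B \<subseteq> symmetries_le F k" "jetfun.independent B" "symmetries_le F k \<subseteq> jetfun.span B"
      using jetfun.maximal_independent_subset .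
    then have "finite B"
      using jetfun.independent_span_bound[OF B0(1) B(2)] B0(2) by blast
    then show ?thesis using B unfolding finite_dimensional_def by blast
  qed
  moreover have "Q \<in> jetfun.span {H \<in> symmetries F.
      \<exists>m. m < jetfun.dim (symmetries_le F k) \<and> quasipolynomial k m H}"
    if Q: "Q \<in> symmetries F" "jet_ord Q = k" for Q k
  proof -
    let ?V = "symmetries_le F k"
    define d where "d = jetfun.dim ?V"
    have QV: "Q \<in> ?V" using Q by (simp add: symmetries_le_def)
    obtain B where B: "finite B" "?V \<subseteq> jetfun.span B" using finite_span by blast
    have lin: "jetfun.linear_map_on ?V (pd Jt)"
      unfolding symmetries_le_eq
      by (intro linear_map_on_pd subspace_symmetries_less jet_F) (simp add: symmetries_less_def)
    have inv: "pd Jt ` ?V \<subseteq> ?V"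
      unfolding symmetries_le_eq by (intro image_subsetI pd_symmetries_less jet_F pd_F) auto
    \<comment> \<open>The degree bound makes \<open>d\<close> an exponent that serves for every
      eigenvalue.\<close>
    obtain P where "P \<noteq> 0" "degree P \<le> d" "jetfun.poly_op P (pd Jt) Q = 0"
      using jetfun.exists_annihilating_poly[OF B inv QV] by (auto simp: d_def)
    then have "Q \<in> jetfun.span {w \<in> ?V. \<exists>\<mu>. jetfun.poly_op ([:- \<mu>, 1:] ^ d) (pd Jt) w = 0}"
      by (rule jetfun.generalized_eigenspaces_span[OF lin inv QV])
    \<comment> \<open>Inserting 0 leaves the span unchanged and covers \<open>d = 0\<close>, where
      no admissible \<open>m\<close> exists.\<close>
    also have "\<dots> \<subseteq> jetfun.span (insert 0 {H \<in> symmetries F. \<exists>m<d. quasipolynomial k m H})"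
    proof (intro jetfun.span_mono subsetI)
      fix w
      assume "w \<in> {w \<in> ?V. \<exists>\<mu>. jetfun.poly_op ([:- \<mu>, 1:] ^ d) (pd Jt) w = 0}"
      then obtain \<mu> where w: "w \<in> ?V" "jetfun.poly_op ([:- \<mu>, 1:] ^ d) (pd Jt) w = 0" by blast
      then have "jet_function w" "ord_less w (Suc k)"
        by (auto simp: symmetries_le_eq symmetries_less_def)
      from generalized_eigenvector_quasipolynomial[OF this w(2)] obtain h where
        h: "\<forall>j. jet_function (h j) \<and> depends_on UNIV ({Jx} \<union> {Ju i |i. i \<le> k}) (h j)"
        and w_eq: "\<forall>p. w p = exp (\<mu> * of_real (p Jt)) * (\<Sum>j<d. of_real (p Jt) ^ j * h j p)"
        by blast
      show "w \<in> insert 0 {H \<in> symmetries F. \<exists>m<d. quasipolynomial k m H}"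
      proof (cases d)
        case 0
        then have "w = 0" using w(2) by (simp only: power_0 jetfun.poly_op_1)
        then show ?thesis by simp
      next
        case (Suc m)
        have "quasipolynomial k m w"
          unfolding quasipolynomial_def
        proof (intro exI[of _ \<mu>] exI[of _ h] conjI)
          show "\<forall>p. w p = exp (\<mu> * of_real (p Jt)) * (\<Sum>j\<le>m. of_real (p Jt) ^ j * h j p)"
            using w_eq unfolding Suc lessThan_Suc_atMost .
        qed (use h jet_function_smooth in blast)
        moreover have "w \<in> symmetries F" using w(1) by (simp add: symmetries_le_def)
        ultimately show ?thesis using Suc by blast
      qed
    qed
    finally show ?thesis by (simp add: d_def)
  qed
  ultimately show ?thesis by blast
qed

end
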